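(* Consider $$dx_t=\frac1\varepsilon\bigl[\mu(t)x_t-x_t^3\bigr]dt+\frac{\sigma}{\sqrt\varepsilon}dW_t,$$ where $\mu(t)=t+O(t^2)$ is monotonously increasing on $[t_0,T]$, $t_0<0<T$. Fix $t_1\in[t_0,0)$ bounded away from $0$, let $x^{\det}_t$ be the solution of the deterministic equation ($\sigma=0$) with a given initial condition $x^{\det}_{t_0}=x_0>0$, and let the stochastic process start at time $t_1$ at $x_{t_1}=x^{\det}_{t_1}$. Put $\alpha(t,s)=\int_s^t\mu(u)du$, $$\bar v(t)=\bar v_0e^{2\alpha(t,t_1)/\varepsilon}+\frac{\sigma^2}{\varepsilon}\int_{t_1}^te^{2\alpha(t,s)/\varepsilon}ds$$ with a positive constant $\bar v_0$, and $\mathcal B(h)=\{(x,t):t_1\le t\le\sqrt\varepsilon,\ |x-x^{\det}_t|<h\sqrt{\bar v(t)}\}$. Then there is a constant $h_0>0$ such that for all $h\le h_0\sqrt\varepsilon/\sigma$, $$\mathbb P^{t_1,x_{t_1}}\{\tau_{\mathcal B(h)}<\sqrt\varepsilon\}\le C_\varepsilon e^{-\kappa h^2},\qquad C_\varepsilon=\frac{|\alpha(\sqrt\varepsilon,t_1)|+O(\varepsilon)}{\varepsilon^2},\qquad \kappa=\frac12-O(\sqrt\varepsilon)-O\Bigl(\frac{\sigma^2h^2}{\varepsilon}\Bigr),$$ where $\tau_{\mathcal B(h)}$ is the first-exit time of $(x_t,t)$ from $\mathcal B(h)$.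
   Context: $W_t$ standard Brownian motion; $\varepsilon,\sigma>0$ small. The drift derives from the potential $V(x,t)=\tfrac14x^4-\tfrac12\mu(t)x^2$, which passes from a single well to a double well at $t=0$ (pitchfork bifurcation). *)

theory Defs
  imports "HOL-Probability.Probability"
begin

definition brownian_motion :: "'a measure \<Rightarrow> (real \<Rightarrow> 'a \<Rightarrow> real) \<Rightarrow> bool" where
  "brownian_motion M W \<longleftrightarrow>
     prob_space M \<and>
     (\<forall>t\<ge>0. W t \<in> borel_measurable M) \<and>
     (\<forall>\<omega>\<in>space M. W 0 \<omega> = 0) \<and>
     (\<forall>\<omega>\<in>space M. continuous_on {0..} (\<lambda>t. W t \<omega>)) \<and>
     (\<forall>s t. 0 \<le> s \<and> s < t \<longrightarrow>
        distributed M lborel (\<lambda>\<omega>. W t \<omega> - W s \<omega>)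
          (\<lambda>x. ennreal (normal_density 0 (sqrt (t - s)) x))) \<and>
     (\<forall>ts::real list. sorted_wrt (<) ts \<and> (\<forall>t\<in>set ts. 0 \<le> t) \<longrightarrow>
        prob_space.indep_vars M (\<lambda>_. borel)
          (\<lambda>i \<omega>. W (ts ! Suc i) \<omega> - W (ts ! i) \<omega>) {..<length ts - 1})"

text \<open>alpha(t,s) = integral of mu from s to t (used for s <= t).\<close>
definition alpha :: "(real \<Rightarrow> real) \<Rightarrow> real \<Rightarrow> real \<Rightarrow> real" where
  "alpha \<mu> t s = integral {s..t} \<mu>"

definition vbar :: "(real \<Rightarrow> real) \<Rightarrow> real \<Rightarrow> real \<Rightarrow> real \<Rightarrow> real \<Rightarrow> real \<Rightarrow> real" where
  "vbar \<mu> \<epsilon> \<sigma> t1 v0 t =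
     v0 * exp (2 * alpha \<mu> t t1 / \<epsilon>)
     + \<sigma>\<^sup>2 / \<epsilon> * integral {t1..t} (\<lambda>s. exp (2 * alpha \<mu> t s / \<epsilon>))"

definition Bset :: "(real \<Rightarrow> real) \<Rightarrow> real \<Rightarrow> real \<Rightarrow> real \<Rightarrow> real \<Rightarrow> (real \<Rightarrow> real) \<Rightarrow> real
                    \<Rightarrow> (real \<times> real) set" where
  "Bset \<mu> \<epsilon> \<sigma> t1 v0 xd h =
     {(x, t). t1 \<le> t \<and> t \<le> sqrt \<epsilon> \<and> \<bar>x - xd t\<bar> < h * sqrt (vbar \<mu> \<epsilon> \<sigma> t1 v0 t)}"

definition exit_time :: "(real \<times> real) set \<Rightarrow> real \<Rightarrow> (real \<Rightarrow> 'a \<Rightarrow> real) \<Rightarrow> 'a \<Rightarrow> real" where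
  "exit_time B t1 X \<omega> = Inf {t. t1 \<le> t \<and> (X t \<omega>, t) \<notin> B}"

definition det_solution :: "(real \<Rightarrow> real) \<Rightarrow> real \<Rightarrow> real \<Rightarrow> real \<Rightarrow> real \<Rightarrow> (real \<Rightarrow> real) \<Rightarrow> bool" where
  "det_solution \<mu> \<epsilon> t0 T x0 xd \<longleftrightarrow> xd t0 = x0 \<and>
     (\<forall>t\<in>{t0..T}. (xd has_real_derivative (\<mu> t * xd t - (xd t)^3) / \<epsilon>) (at t within {t0..T}))"

text \<open>Pathwise (additive noise) form of the SDE
  dx = (mu x - x^3)/eps dt + sigma/sqrt eps dW on [t1, t2], started at x(t1)=xi,
  driven by the Brownian motion W(t - t1).\<close>
definition sde_solution :: "'a measure \<Rightarrow> (real \<Rightarrow> 'a \<Rightarrow> real) \<Rightarrow> (real \<Rightarrow> real) \<Rightarrow> real \<Rightarrow> real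
     \<Rightarrow> real \<Rightarrow> real \<Rightarrow> real \<Rightarrow> (real \<Rightarrow> 'a \<Rightarrow> real) \<Rightarrow> bool" where
  "sde_solution M W \<mu> \<epsilon> \<sigma> t1 t2 xi X \<longleftrightarrow>
     (\<forall>t\<in>{t1..t2}. X t \<in> borel_measurable M) \<and>
     (\<forall>\<omega>\<in>space M. continuous_on {t1..t2} (\<lambda>t. X t \<omega>) \<and>
        (\<forall>t\<in>{t1..t2}. X t \<omega> = xi
            + (1 / \<epsilon>) * integral {t1..t} (\<lambda>s. \<mu> s * X s \<omega> - (X s \<omega>)^3)
            + \<sigma> / sqrt \<epsilon> * W (t - t1) \<omega>))"

end

theory Submission
  imports Defs
begin

text \<open>
  Let \<open>y = x - x\<^bsup>det\<^esup>\<close>, \<open>f t = exp (- \<alpha>(t,t\<^sub>1) / \<epsilon>)\<close> and \<open>Y = f y\<close>. As \<open>x \<mapsto> - x\<^sup>3\<close> is decreasing,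
  \<open>dY = - k Y dt + dN\<close> with \<open>k \<ge> 0\<close> and \<open>dN = (\<sigma> / sqrt \<epsilon>) f dW\<close>, so that \<open>\<bar>Y\<bar>\<close> never exceeds the
  largest rise or fall of the Gaussian martingale \<open>N\<close>, and no bound on the nonlinearity is needed.
  This rise has Gaussian tails, since for a reflected random walk \<open>D\<close> with Gaussian steps and
  variance \<open>V\<close> the process \<open>cosh (\<lambda> D) exp (- \<lambda>\<^sup>2 V / 2)\<close> is a supermartingale. Finally, the process
  leaves \<open>B(h)\<close> when \<open>\<bar>Y\<bar> \<ge> h sqrt g\<close>, where \<open>g = v\<^sub>0 + Var N\<close> is increasing. Cutting time where \<open>g\<close>
  grows by the factor \<open>exp (sqrt \<epsilon>)\<close> gives at most a multiple of \<open>sqrt \<epsilon> / \<epsilon>\<^sup>2\<close> pieces, each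
  contributing a multiple of \<open>exp (- (1 - sqrt \<epsilon>) h\<^sup>2 / 2)\<close>.
\<close>

section \<open>Exponential moments of reflected random walks\<close>

text \<open>Completing the square: the exponential weight moves the mean of the density to
  \<open>a * s\<^sup>2\<close> and leaves a constant factor. The nonnegative integral spares every
  integrability argument.\<close>

lemma (in prob_space) nn_integral_exp_normal:
  assumes X: "distributed M lborel X (\<lambda>x. ennreal (normal_density 0 s x))" and s: "s > 0"
  shows "(\<integral>\<^sup>+\<omega>. ennreal (exp (a * X \<omega>)) \<partial>M) = ennreal (exp (a\<^sup>2 * s\<^sup>2 / 2))"
proof -
  have "(\<integral>\<^sup>+\<omega>. ennreal (exp (a * X \<omega>)) \<partial>M)
      = (\<integral>\<^sup>+x. ennreal (normal_density 0 s x) * ennreal (exp (a * x)) \<partial>lborel)"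
    by (rule distributed_nn_integral[OF X, symmetric]) simp
  also have "\<dots> = (\<integral>\<^sup>+x. ennreal (exp (a\<^sup>2 * s\<^sup>2 / 2)) * ennreal (normal_density (a * s\<^sup>2) s x) \<partial>lborel)"
  proof (rule nn_integral_cong)
    fix x :: real
    have "- (x\<^sup>2) / (2 * s\<^sup>2) + a * x = a\<^sup>2 * s\<^sup>2 / 2 - (x - a * s\<^sup>2)\<^sup>2 / (2 * s\<^sup>2)"
      using s by (simp add: field_simps power2_eq_square)
    then have "normal_density 0 s x * exp (a * x) = exp (a\<^sup>2 * s\<^sup>2 / 2) * normal_density (a * s\<^sup>2) s x"
      by (simp add: normal_density_def flip: exp_add)
    then show "ennreal (normal_density 0 s x) * ennreal (exp (a * x))
        = ennreal (exp (a\<^sup>2 * s\<^sup>2 / 2)) * ennreal (normal_density (a * s\<^sup>2) s x)"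
      by (simp flip: ennreal_mult')
  qed
  also have "\<dots> = ennreal (exp (a\<^sup>2 * s\<^sup>2 / 2))"
    using s by (simp add: nn_integral_cmult nn_integral_eq_integral)
  finally show ?thesis .
qed

text \<open>Lindley recursion (the CUSUM process): without the freezing, its value is the largest
  sum over a block of increments that ends at time \<open>n\<close>, the empty block included.
  Freezing at \<open>H\<close> lets a passage at any earlier time be read off at time
  \<open>n\<close>, so that Markov's inequality at one time replaces a maximal inequality.\<close>

primrec killed_reflected_walk :: "real \<Rightarrow> (nat \<Rightarrow> real) \<Rightarrow> nat \<Rightarrow> real" where
  "killed_reflected_walk H x 0 = 0"
| "killed_reflected_walk H x (Suc n) =
     (if H \<le> killed_reflected_walk H x n then killed_reflected_walk H x n
      else max 0 (killed_reflected_walk H x n + x n))"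

lemma killed_reflected_walk_nonneg: "0 \<le> killed_reflected_walk H x n"
  by (induction n) auto

lemma killed_reflected_walk_cong:
  "(\<And>i. i < n \<Longrightarrow> x i = y i) \<Longrightarrow> killed_reflected_walk H x n = killed_reflected_walk H y n"
  by (induction n) auto

lemma killed_reflected_walk_absorbed:
  assumes "m \<le> n" "H \<le> killed_reflected_walk H x m"
  shows "H \<le> killed_reflected_walk H x n"
  using assms by (induction n rule: dec_induct) auto

text \<open>Reflection at 0 forgets the past: at time \<open>i\<close> the walk is nonnegative, so
  until it is frozen it dominates the sum of the increments from \<open>i\<close> on. Freezing
  carries the passage from \<open>j\<close> to \<open>n\<close>.\<close>

lemma killed_reflected_walk_ge:
  assumes "i \<le> j" "j \<le> n" "H \<le> (\<Sum>k\<in>{i..<j}. x k)"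
  shows "H \<le> killed_reflected_walk H x n"
proof -
  have "H \<le> killed_reflected_walk H x j \<or> (\<Sum>k\<in>{i..<j}. x k) \<le> killed_reflected_walk H x j"
    using assms(1)
  proof (induction j rule: dec_induct)
    case base
    then show ?case by (simp add: killed_reflected_walk_nonneg)
  next
    case (step j)
    then show ?case by (auto simp: max_def)
  qed
  then show ?thesis
    using assms by (meson killed_reflected_walk_absorbed order_trans)
qed

lemma measurable_killed_reflected_walk:
  assumes "\<And>i. i < n \<Longrightarrow> (\<lambda>\<omega>. \<xi> i \<omega>) \<in> borel_measurable M"
  shows "(\<lambda>\<omega>. killed_reflected_walk H (\<lambda>i. \<xi> i \<omega>) n) \<in> borel_measurable M"
  using assms
proof (induction n)
  case (Suc n)
  have [measurable]: "(\<lambda>\<omega>. killed_reflected_walk H (\<lambda>i. \<xi> i \<omega>) n) \<in> borel_measurable M"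
    "\<xi> n \<in> borel_measurable M" using Suc by auto
  show ?case by simp
qed simp

text \<open>Since \<open>max 0 u \<le> \<bar>u\<bar>\<close>, reflection only decreases \<open>cosh\<close>, so that
  \<open>cosh (\<lambda> D\<^sub>n)\<close> grows on average no faster than for the free walk.\<close>
lemma (in prob_space) nn_integral_cosh_killed_reflected_walk:
  assumes indep: "indep_vars (\<lambda>_. borel) \<xi> {..<n}"
    and mgf: "\<And>i a. i < n \<Longrightarrow> (\<integral>\<^sup>+\<omega>. ennreal (exp (a * \<xi> i \<omega>)) \<partial>M) \<le> ennreal (exp (a\<^sup>2 * v i / 2))"
    and v: "\<And>i. i < n \<Longrightarrow> 0 \<le> v i"
    and m: "m \<le> n"
  shows "(\<integral>\<^sup>+\<omega>. ennreal (cosh (l * killed_reflected_walk H (\<lambda>i. \<xi> i \<omega>) m)) \<partial>M)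
           \<le> ennreal (exp (l\<^sup>2 * (\<Sum>i<m. v i) / 2))"
  using m
proof (induction m)
  case 0
  then show ?case by (simp add: emeasure_space_1)
next
  case (Suc m)
  define D where "D = (\<lambda>\<omega>. killed_reflected_walk H (\<lambda>i. \<xi> i \<omega>) m)"
  \<comment> \<open>\<open>A\<close> is the part already frozen. On the rest,
    \<open>cosh (l * (d + x))\<close> splits as
    \<open>B l d * exp (l * x) + B (- l) d * exp (- l * x)\<close>, a sum of products of a function
    of the past and a function of the next increment, to which independence applies.\<close>
  define A where "A = (\<lambda>d. if H \<le> d then cosh (l * d) else (0::real))"
  define B where "B = (\<lambda>k d. if H \<le> d then 0 else exp (k * d) / (2::real))"
  define e where "e = exp (l\<^sup>2 * v m / 2)"
  have [measurable]: "\<xi> i \<in> borel_measurable M" if "i < n" for i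
    using indep that by (auto simp: indep_vars_def)
  have mm: "\<xi> m \<in> borel_measurable M" using Suc by simp
  note [measurable] = mm
  have D [measurable]: "D \<in> borel_measurable M"
    unfolding D_def using Suc by (intro measurable_killed_reflected_walk) auto
  have [measurable]: "A \<in> borel_measurable borel" "\<And>k. B k \<in> borel_measurable borel"
    unfolding A_def B_def cosh_def by measurable
  have e1: "1 \<le> e" using v[of m] Suc by (simp add: e_def)
  have "indep_var (PiM {..<m} (\<lambda>_. borel)) (\<lambda>\<omega>. restrict (\<lambda>i. \<xi> i \<omega>) {..<m})
      (PiM {m} (\<lambda>_. borel)) (\<lambda>\<omega>. restrict (\<lambda>i. \<xi> i \<omega>) {m})"
    using Suc by (intro indep_var_restrict[OF indep]) auto
  then have ind: "indep_var borel ((\<lambda>x. killed_reflected_walk H x m) \<circ> (\<lambda>\<omega>. restrict (\<lambda>i. \<xi> i \<omega>) {..<m}))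
      borel ((\<lambda>x. x m) \<circ> (\<lambda>\<omega>. restrict (\<lambda>i. \<xi> i \<omega>) {m}))"
    by (rule indep_var_compose) (auto intro!: measurable_killed_reflected_walk)
  moreover have "(\<lambda>x. killed_reflected_walk H x m) \<circ> (\<lambda>\<omega>. restrict (\<lambda>i. \<xi> i \<omega>) {..<m}) = D"
    by (auto simp: fun_eq_iff D_def intro: killed_reflected_walk_cong)
  ultimately have ind: "indep_var borel D borel (\<xi> m)"
    by (simp add: comp_def)
  have BE: "(\<integral>\<^sup>+\<omega>. ennreal (B k (D \<omega>)) * ennreal (exp (k * \<xi> m \<omega>)) \<partial>M)
        \<le> (\<integral>\<^sup>+\<omega>. ennreal (B k (D \<omega>)) \<partial>M) * ennreal e" if "k\<^sup>2 = l\<^sup>2" for k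
  proof -
    have "indep_var borel ((\<lambda>d. ennreal (B k d)) \<circ> D) borel ((\<lambda>x. ennreal (exp (k * x))) \<circ> \<xi> m)"
      by (rule indep_var_compose[OF ind]) auto
    then have "indep_vars (\<lambda>_. borel) (case_bool ((\<lambda>d. ennreal (B k d)) \<circ> D) ((\<lambda>x. ennreal (exp (k * x))) \<circ> \<xi> m)) UNIV"
      by (simp add: indep_var_def case_bool_if if_distrib cong: if_cong)
    from indep_vars_nn_integral[OF _ this]
    have "(\<integral>\<^sup>+\<omega>. ennreal (B k (D \<omega>)) * ennreal (exp (k * \<xi> m \<omega>)) \<partial>M)
        = (\<integral>\<^sup>+\<omega>. ennreal (B k (D \<omega>)) \<partial>M) * (\<integral>\<^sup>+\<omega>. ennreal (exp (k * \<xi> m \<omega>)) \<partial>M)"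
      by (simp add: UNIV_bool comp_def mult.commute)
    also have "\<dots> \<le> (\<integral>\<^sup>+\<omega>. ennreal (B k (D \<omega>)) \<partial>M) * ennreal e"
      using mgf[of m k] Suc that by (intro mult_left_mono) (auto simp: e_def)
    finally show ?thesis .
  qed
  have cosh_max: "cosh (l * max 0 u) \<le> cosh (l * u)" for u
    by (auto simp: max_def cosh_real_ge_1)
  have "(\<integral>\<^sup>+\<omega>. ennreal (cosh (l * killed_reflected_walk H (\<lambda>i. \<xi> i \<omega>) (Suc m))) \<partial>M)
     \<le> (\<integral>\<^sup>+\<omega>. ennreal (A (D \<omega>)) * ennreal e + (ennreal (B l (D \<omega>)) * ennreal (exp (l * \<xi> m \<omega>))
          + ennreal (B (- l) (D \<omega>)) * ennreal (exp (- l * \<xi> m \<omega>))) \<partial>M)"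
  proof (intro nn_integral_mono)
    fix \<omega>
    have "cosh (l * killed_reflected_walk H (\<lambda>i. \<xi> i \<omega>) (Suc m))
       \<le> A (D \<omega>) * e + (B l (D \<omega>) * exp (l * \<xi> m \<omega>) + B (- l) (D \<omega>) * exp (- l * \<xi> m \<omega>))"
    proof (cases "H \<le> D \<omega>")
      case True
      then show ?thesis using e1 
        by (simp add: A_def B_def D_def mult_le_cancel_left1 not_less cosh_real_nonneg not_less[THEN iffD2, OF cosh_real_nonneg])
    next
      case False
      then have "cosh (l * killed_reflected_walk H (\<lambda>i. \<xi> i \<omega>) (Suc m)) \<le> cosh (l * (D \<omega> + \<xi> m \<omega>))"
        using cosh_max by (simp add: D_def)
      also have "\<dots> = B l (D \<omega>) * exp (l * \<xi> m \<omega>) + B (- l) (D \<omega>) * exp (- l * \<xi> m \<omega>)"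
        using False by (simp add: B_def cosh_def exp_add[symmetric] algebra_simps add_divide_distrib)
      finally show ?thesis using False by (simp add: A_def)
    qed
    then show "ennreal (cosh (l * killed_reflected_walk H (\<lambda>i. \<xi> i \<omega>) (Suc m)))
       \<le> ennreal (A (D \<omega>)) * ennreal e + (ennreal (B l (D \<omega>)) * ennreal (exp (l * \<xi> m \<omega>))
          + ennreal (B (- l) (D \<omega>)) * ennreal (exp (- l * \<xi> m \<omega>)))"
      using e1 by (simp add: A_def B_def cosh_real_nonneg flip: ennreal_mult ennreal_plus)
  qed
  also have "\<dots> = (\<integral>\<^sup>+\<omega>. ennreal (A (D \<omega>)) \<partial>M) * ennreal e
      + ((\<integral>\<^sup>+\<omega>. ennreal (B l (D \<omega>)) * ennreal (exp (l * \<xi> m \<omega>)) \<partial>M)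
      + (\<integral>\<^sup>+\<omega>. ennreal (B (- l) (D \<omega>)) * ennreal (exp (- l * \<xi> m \<omega>)) \<partial>M))"
    by (simp add: nn_integral_add nn_integral_multc)
  also have "\<dots> \<le> (\<integral>\<^sup>+\<omega>. ennreal (A (D \<omega>)) \<partial>M) * ennreal e
      + ((\<integral>\<^sup>+\<omega>. ennreal (B l (D \<omega>)) \<partial>M) * ennreal e + (\<integral>\<^sup>+\<omega>. ennreal (B (- l) (D \<omega>)) \<partial>M) * ennreal e)"
    by (intro add_mono BE order_refl) auto
  also have "\<dots> = (\<integral>\<^sup>+\<omega>. ennreal (A (D \<omega>)) + (ennreal (B l (D \<omega>)) + ennreal (B (- l) (D \<omega>))) \<partial>M) * ennreal e"
    by (simp add: nn_integral_add distrib_right)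
  also have "\<dots> = (\<integral>\<^sup>+\<omega>. ennreal (cosh (l * D \<omega>)) \<partial>M) * ennreal e"
    by (intro arg_cong2[where f="(*)"] nn_integral_cong refl)
       (auto simp: A_def B_def cosh_def add_divide_distrib simp flip: ennreal_plus)
  also have "\<dots> \<le> ennreal (exp (l\<^sup>2 * (\<Sum>i<m. v i) / 2)) * ennreal e"
    using Suc by (intro mult_right_mono) (auto simp: D_def)
  also have "\<dots> = ennreal (exp (l\<^sup>2 * (\<Sum>i<Suc m. v i) / 2))"
    by (simp add: e_def algebra_simps add_divide_distrib flip: ennreal_mult exp_add)
  finally show ?case .
qed

text \<open>Markov's inequality for \<open>cosh\<close>; the factor 2 comes from
  \<open>exp z \<le> 2 * cosh z\<close>. The parameter \<open>l\<close> stays free and is optimised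
  once the total variance has been bounded.\<close>

lemma (in prob_space) prob_killed_reflected_walk:
  assumes indep: "indep_vars (\<lambda>_. borel) \<xi> {..<n}"
    and mgf: "\<And>i a. i < n \<Longrightarrow> (\<integral>\<^sup>+\<omega>. ennreal (exp (a * \<xi> i \<omega>)) \<partial>M) \<le> ennreal (exp (a\<^sup>2 * v i / 2))"
    and v: "\<And>i. i < n \<Longrightarrow> 0 \<le> v i"
    and H: "0 \<le> H" and l: "0 \<le> l"
  shows "prob {\<omega>\<in>space M. H \<le> killed_reflected_walk H (\<lambda>i. \<xi> i \<omega>) n}
           \<le> 2 * exp (l\<^sup>2 * (\<Sum>i<n. v i) / 2 - l * H)"
proof -
  define D where "D = (\<lambda>\<omega>. killed_reflected_walk H (\<lambda>i. \<xi> i \<omega>) n)"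
  have [measurable]: "D \<in> borel_measurable M"
    unfolding D_def using indep by (intro measurable_killed_reflected_walk) (auto simp: indep_vars_def)
  have "emeasure M {\<omega>\<in>space M. H \<le> D \<omega>} \<le> emeasure M {\<omega>\<in>space M. 1 \<le> ennreal (2 * exp (- l * H)) * ennreal (cosh (l * D \<omega>))}"
  proof (rule emeasure_mono)
    have "1 \<le> 2 * exp (- l * H) * cosh (l * d)" if "H \<le> d" for d
    proof -
      have "exp (l * H) \<le> exp (l * d)" using l that by (simp add: mult_left_mono)
      also have "\<dots> \<le> 2 * cosh (l * d)" by (simp add: cosh_def)
      finally have "exp (- l * H) * exp (l * H) \<le> exp (- l * H) * (2 * cosh (l * d))"
        by (intro mult_left_mono) auto
      then show ?thesis by (simp add: mult_ac flip: exp_add)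
    qed
    then show "{\<omega>\<in>space M. H \<le> D \<omega>} \<subseteq> {\<omega>\<in>space M. 1 \<le> ennreal (2 * exp (- l * H)) * ennreal (cosh (l * D \<omega>))}"
      by (auto simp: cosh_real_nonneg simp flip: ennreal_mult)
  qed (simp add: cosh_def)
  also have "\<dots> \<le> ennreal (2 * exp (- l * H)) * (\<integral>\<^sup>+\<omega>. ennreal (cosh (l * D \<omega>)) * indicator (space M) \<omega> \<partial>M)"
    by (rule nn_integral_Markov_inequality) (auto simp: cosh_def)
  also have "(\<integral>\<^sup>+\<omega>. ennreal (cosh (l * D \<omega>)) * indicator (space M) \<omega> \<partial>M) = (\<integral>\<^sup>+\<omega>. ennreal (cosh (l * D \<omega>)) \<partial>M)"
    by (intro nn_integral_cong) auto
  also have "ennreal (2 * exp (- l * H)) * \<dots> \<le> ennreal (2 * exp (- l * H)) * ennreal (exp (l\<^sup>2 * (\<Sum>i<n. v i) / 2))"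
    unfolding D_def by (intro mult_left_mono nn_integral_cosh_killed_reflected_walk[OF indep mgf v]) auto
  also have "\<dots> = ennreal (2 * exp (l\<^sup>2 * (\<Sum>i<n. v i) / 2 - l * H))"
    by (simp add: algebra_simps flip: ennreal_mult exp_add)
  finally show ?thesis
    by (simp add: D_def emeasure_eq_measure)
qed

section \<open>Equidistant grids and Riemann sums\<close>

definition grid :: "real \<Rightarrow> real \<Rightarrow> nat \<Rightarrow> nat \<Rightarrow> real" where
  "grid a b n k = a + real k * ((b - a) / real n)"

lemma grid_Suc: "grid a b n (Suc k) = grid a b n k + (b - a) / real n"
  by (simp add: grid_def distrib_right add_divide_distrib)

lemma grid_0 [simp]: "grid a b n 0 = a"
  by (simp add: grid_def)

lemma grid_last [simp]: "n > 0 \<Longrightarrow> grid a b n n = b"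
  by (simp add: grid_def)

lemma grid_mono: "a \<le> b \<Longrightarrow> i \<le> j \<Longrightarrow> grid a b n i \<le> grid a b n j"
  by (auto simp: grid_def simp del: times_divide_eq_right intro!: mult_right_mono)

lemma grid_in:
  assumes "a \<le> b" "k \<le> n" "n > 0"
  shows "grid a b n k \<in> {a..b}"
  using grid_mono[OF assms(1), of 0 k n] grid_mono[OF assms(1,2), of n] assms by simp

lemma grid_mesh_tendsto: "(\<lambda>n. (b - a) / real n) \<longlonglongrightarrow> 0"
  by (rule lim_const_over_n)

lemma sum_integral_grid:
  fixes f :: "real \<Rightarrow> real"
  assumes "continuous_on {a..b} f" "a \<le> b" "n > 0"
  shows "(\<Sum>k<n. integral {grid a b n k..grid a b n (Suc k)} f) = integral {a..b} f"
proof -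
  have "(\<Sum>k<m. integral {grid a b n k..grid a b n (Suc k)} f) = integral {a..grid a b n m} f"
    if "m \<le> n" for m
    using that
  proof (induction m)
    case (Suc m)
    have "integral {a..grid a b n m} f + integral {grid a b n m..grid a b n (Suc m)} f
        = integral {a..grid a b n (Suc m)} f"
      using Suc grid_in[of a b m n] grid_in[of a b "Suc m" n] grid_mono[of a b m "Suc m" n] assms
      by (intro Henstock_Kurzweil_Integration.integral_combine integrable_continuous_real
            continuous_on_subset[OF assms(1)]) auto
    then show ?case using Suc by simp
  qed simp
  from this[of n] assms show ?thesis by simp
qed

text \<open>Uniform continuity on a compact interval, phrased for the mesh and eventually in
  \<open>n\<close>, so that several functions can share one fine grid.\<close>

lemma eventually_oscillation_le:
  fixes f :: "real \<Rightarrow> real"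
  assumes "continuous_on {a..b} f" "0 < e"
  shows "\<forall>\<^sub>F n in sequentially. \<forall>u\<in>{a..b}. \<forall>v\<in>{a..b}. \<bar>u - v\<bar> \<le> (b - a) / real n \<longrightarrow> \<bar>f u - f v\<bar> \<le> e"
proof -
  have "uniformly_continuous_on {a..b} f"
    using assms by (intro compact_uniformly_continuous) auto
  then obtain d where d: "d > 0" "\<And>u v. u \<in> {a..b} \<Longrightarrow> v \<in> {a..b} \<Longrightarrow> dist v u < d \<Longrightarrow> dist (f v) (f u) < e"
    using assms(2) unfolding uniformly_continuous_on_def by metis
  have "\<forall>\<^sub>F n in sequentially. (b - a) / real n < d"
    using order_tendstoD(2)[OF grid_mesh_tendsto d(1)] .
  then show ?thesis
    by eventually_elim (use d(2) in \<open>force simp: dist_real_def\<close>)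
qed

lemma Riemann_sum_tendsto:
  fixes f :: "real \<Rightarrow> real"
  assumes f: "continuous_on {a..b} f" and ab: "a \<le> b"
  shows "(\<lambda>n. \<Sum>k<n. f (grid a b n k) * ((b - a) / real n)) \<longlonglongrightarrow> integral {a..b} f"
proof (rule LIMSEQ_I)
  fix e :: real assume e: "0 < e"
  \<comment> \<open>The added 1 keeps \<open>w\<close> positive when \<open>a = b\<close> and makes
    \<open>\<eta> * (b - a) < e\<close> strict.\<close>
  define w where "w = b - a + 1"
  define \<eta> where "\<eta> = e / (2 * w)"
  have w: "0 < w" using ab by (simp add: w_def)
  then have "\<eta> > 0" "\<eta> * w = e / 2" using e by (simp_all add: \<eta>_def)
  then have \<eta>: "\<eta> > 0" "\<eta> * (b - a) < e" using e by (simp_all add: w_def distrib_left)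
  have "\<forall>\<^sub>F n in sequentially. norm ((\<Sum>k<n. f (grid a b n k) * ((b - a) / real n)) - integral {a..b} f) < e"
    using eventually_oscillation_le[OF f \<eta>(1)] eventually_gt_at_top[of 0]
  proof eventually_elim
    case (elim n)
    define \<delta> where "\<delta> = (b - a) / real n"
    have \<delta>: "0 \<le> \<delta>" using ab by (simp add: \<delta>_def)
    have *: "\<bar>f (grid a b n k) * \<delta> - integral {grid a b n k..grid a b n (Suc k)} f\<bar> \<le> \<eta> * \<delta>" if "k < n" for k
    proof -
      let ?I = "{grid a b n k..grid a b n (Suc k)}"
      have I: "?I \<subseteq> {a..b}" and len: "grid a b n (Suc k) = grid a b n k + \<delta>"
        using that elim ab grid_in[of a b k n] grid_in[of a b "Suc k" n] by (auto simp: grid_Suc \<delta>_def)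
      have fI: "continuous_on ?I f" by (rule continuous_on_subset[OF f I])
      have "norm (integral ?I (\<lambda>s. f (grid a b n k) - f s)) \<le> \<eta> * (grid a b n (Suc k) - grid a b n k)"
      proof (rule integral_bound)
        fix s assume s: "s \<in> ?I"
        then show "norm (f (grid a b n k) - f s) \<le> \<eta>"
          using elim(1) I len unfolding \<delta>_def[symmetric] by auto
      qed (use len \<delta> fI in \<open>auto intro: continuous_on_diff\<close>)
      moreover have "integral ?I (\<lambda>s. f (grid a b n k) - f s) = f (grid a b n k) * \<delta> - integral ?I f"
        using len \<delta> integrable_continuous_real[OF fI]
        by (subst Henstock_Kurzweil_Integration.integral_diff) auto
      ultimately show ?thesis using len by simp
    qed
    have "\<bar>(\<Sum>k<n. f (grid a b n k) * \<delta>) - integral {a..b} f\<bar>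
        = \<bar>\<Sum>k<n. f (grid a b n k) * \<delta> - integral {grid a b n k..grid a b n (Suc k)} f\<bar>"
      using sum_integral_grid[OF f ab elim(2)] by (simp add: sum_subtractf)
    also have "\<dots> \<le> (\<Sum>k<n. \<eta> * \<delta>)"
      by (intro order_trans[OF sum_abs] sum_mono *) auto
    also have "\<dots> = \<eta> * (b - a)" using elim by (simp add: \<delta>_def)
    finally show ?case using \<eta> by (simp add: \<delta>_def)
  qed
  then show "\<exists>no. \<forall>n\<ge>no. norm ((\<Sum>k<n. f (grid a b n k) * ((b - a) / real n)) - integral {a..b} f) < e"
    by (simp add: eventually_sequentially)
qed

section \<open>Pathwise comparison with the discretised noise\<close>

text \<open>Write \<open>Y = f y\<close>. From the last zero of \<open>y\<close> before \<open>t\<close> onwards the drift of \<open>Y\<close> is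
  nonpositive, so the rise of \<open>Y\<close> is at most that of the Riemann sums of \<open>\<integral>f dZ\<close>.\<close>
lemma eventually_Riemann_sum_rise:
  fixes f f' y \<beta> Z :: "real \<Rightarrow> real"
  assumes f: "\<And>t. t \<in> {a..b} \<Longrightarrow> (f has_real_derivative f' t) (at t within {a..b})"
    and f': "continuous_on {a..b} f'" and y: "continuous_on {a..b} y" and \<beta>: "continuous_on {a..b} \<beta>"
    and fpos: "\<And>t. t \<in> {a..b} \<Longrightarrow> 0 < f t"
    and eq: "\<And>t. t \<in> {a..b} \<Longrightarrow> y t = integral {a..t} \<beta> + Z t"
    and ya: "y a = 0"
    and sgn: "\<And>t. t \<in> {a..b} \<Longrightarrow> 0 \<le> y t \<Longrightarrow> f t * \<beta> t + f' t * y t \<le> 0"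
    and t: "t \<in> {a..b}" "H \<le> f t * y t" and H: "0 \<le> H'" "H' < H"
  shows "\<forall>\<^sub>F n in sequentially. \<exists>i j. i \<le> j \<and> j \<le> n \<and>
           H' \<le> (\<Sum>k\<in>{i..<j}. f (grid a b n k) * (Z (grid a b n (Suc k)) - Z (grid a b n k)))"
proof -
  have ab: "a \<le> b" using t by auto
  have fc: "continuous_on {a..b} f"
    using f DERIV_continuous unfolding continuous_on_eq_continuous_within by blast
  have Yc: "continuous_on {a..b} (\<lambda>t. f t * y t)"
    by (intro continuous_intros fc y)
  obtain B1 where B1: "\<And>s. s \<in> {a..b} \<Longrightarrow> \<bar>\<beta> s\<bar> \<le> B1"
    by (rule continuous_on_compact_bound[OF compact_Icc \<beta>]) auto
  obtain B2 where B2: "\<And>s. s \<in> {a..b} \<Longrightarrow> \<bar>f' s\<bar> \<le> B2"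
    by (rule continuous_on_compact_bound[OF compact_Icc f']) auto
  have B0: "0 \<le> B1" "0 \<le> B2" using B1[OF t(1)] B2[OF t(1)] by linarith+
  \<comment> \<open>The error budget: \<open>2 * \<eta>\<close> for moving \<open>s\<close> and
    \<open>t\<close> to grid points, and \<open>\<eta> * (B1 + B2)\<close> per unit of time for
    freezing \<open>f\<close> and \<open>y\<close> on the cells. Together they amount to
    \<open>H - H'\<close>.\<close>
  define \<eta> where "\<eta> = (H - H') / (2 + (B1 + B2) * (b - a))"
  have den: "2 + (B1 + B2) * (b - a) > 0" using B0 ab by (simp add: add_pos_nonneg)
  have \<eta>: "\<eta> > 0" using H den by (simp add: \<eta>_def)
  have \<eta>H: "2 * \<eta> + \<eta> * (B1 + B2) * (b - a) = H - H'"
  proof -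
    have "\<eta> * (2 + (B1 + B2) * (b - a)) = H - H'" using den by (simp add: \<eta>_def)
    then show ?thesis by (simp add: algebra_simps)
  qed
  obtain s where s: "a \<le> s" "s \<le> t" "y s = 0" and pos: "\<And>u. u \<in> {s..t} \<Longrightarrow> 0 \<le> y u"
  proof -
    define S where "S = {u\<in>{a..t}. y u \<le> 0}"
    have "S = {a..t} \<inter> y -` {..0}" by (auto simp: S_def)
    then have "closed S"
      using t continuous_closed_preimage[of "{a..t}" y "{..0}"] continuous_on_subset[OF y, of "{a..t}"] by auto
    moreover have "a \<in> S" using t ya by (simp add: S_def)
    moreover have bdd: "bdd_above S" by (auto simp: S_def intro!: bdd_aboveI[of _ t])
    ultimately have "Sup S \<in> S" by (intro closed_contains_Sup) auto
    then have s: "a \<le> Sup S" "Sup S \<le> t" "y (Sup S) \<le> 0" by (auto simp: S_def)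
    have "0 < f t * y t" using t H by linarith
    then have "0 < y t" using fpos[OF t(1)] by (simp add: zero_less_mult_iff)
    then obtain u where u: "Sup S \<le> u" "u \<le> t" "y u = 0"
      using IVT'[of y "Sup S" 0 t] s t continuous_on_subset[OF y] by auto
    then have "u \<in> S" using s by (simp add: S_def)
    then have "u = Sup S" using cSup_upper[OF _ bdd] u by (simp add: order_antisym)
    moreover have "0 \<le> y v" if "v \<in> {Sup S..t}" for v
    proof (rule ccontr)
      assume v: "\<not> 0 \<le> y v"
      then have "v \<in> S" using that s by (auto simp: S_def)
      then have "v = Sup S" using cSup_upper[OF _ bdd] that by (simp add: order_antisym)
      then show False using v u \<open>u = Sup S\<close> by simp
    qed
    ultimately show thesis using that[of "Sup S"] s u by simp
  qed
  show ?thesis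
    using eventually_oscillation_le[OF fc \<eta>] eventually_oscillation_le[OF y \<eta>]
      eventually_oscillation_le[OF Yc \<eta>] eventually_gt_at_top[of 0]
  proof eventually_elim
    case (elim n)
    define \<delta> where "\<delta> = (b - a) / real n"
    let ?g = "grid a b n"
    have "s \<noteq> t" using s t H fpos[OF t(1)] by auto
    then have st: "s < t" using s by simp
    then have \<delta>: "0 < \<delta>" using s t elim by (simp add: \<delta>_def)
    have g: "?g k = a + real k * \<delta>" for k by (simp add: grid_def \<delta>_def)
    \<comment> \<open>\<open>i\<close> is the first grid index at or after \<open>s\<close>, and
      \<open>j\<close> the last at or before \<open>t\<close>.\<close>
    define i where "i = nat \<lceil>(s - a) / \<delta>\<rceil>"
    define j where "j = nat \<lfloor>(t - a) / \<delta>\<rfloor>"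
    have i': "(s - a) / \<delta> \<le> real i" "real i < (s - a) / \<delta> + 1"
      using s \<delta> unfolding i_def by (simp_all add: ceiling_less_iff, linarith?)
    have j': "real j \<le> (t - a) / \<delta>" "(t - a) / \<delta> < real j + 1"
      using s st \<delta> unfolding j_def by (simp_all)
    have i: "s \<le> ?g i" "?g i < s + \<delta>" and j: "?g j \<le> t" "t < ?g j + \<delta>"
      using i' j' \<delta> by (simp_all add: g field_simps)
    \<comment> \<open>Such a rise cannot happen within one mesh width, so \<open>s\<close> and
      \<open>t\<close> are more than \<open>\<delta>\<close> apart and
      \<open>i \<le> j\<close>.\<close>
    have "f t * y t - f s * y s > \<eta>"
    proof -
      have "0 \<le> \<eta> * (B1 + B2) * (b - a)" using \<eta> B0 ab by simp
      then show ?thesis using t s H \<eta> \<eta>H by simp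
    qed
    then have "\<not> \<bar>t - s\<bar> \<le> \<delta>"
      using elim(3) s t unfolding \<delta>_def by fastforce
    then have "?g i < ?g (Suc j)" using i j st by (simp add: g algebra_simps)
    then have ij: "i \<le> j" using \<delta> by (simp add: g)
    have jn: "j \<le> n"
    proof -
      have "?g j \<le> ?g n" using j t elim by simp
      then show ?thesis using \<delta> by (simp add: g)
    qed
    \<comment> \<open>Discrete product rule: the increment of \<open>f y\<close> over a cell is
      \<open>f\<close> at the left end times the increment of \<open>y\<close>, plus
      \<open>y\<close> at the right end times the increment of \<open>f\<close>. Replacing these
      frozen values by those at \<open>u\<close> costs at most \<open>\<eta> * (B1 + B2)\<close>,
      and what remains is the drift, nonpositive by \<open>sgn\<close>. The noise enters through
      increments of \<open>Z\<close> alone, so no stochastic integral has to be defined.\<close>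
    have step: "f (?g (Suc k)) * y (?g (Suc k)) - f (?g k) * y (?g k)
        \<le> f (?g k) * (Z (?g (Suc k)) - Z (?g k)) + \<eta> * (B1 + B2) * \<delta>"
      if k: "i \<le> k" "k < j" for k
    proof -
      let ?I = "{?g k..?g (Suc k)}"
      have len: "?g (Suc k) = ?g k + \<delta>" by (simp add: grid_Suc \<delta>_def)
      have lo: "s \<le> ?g k" using i grid_mono[OF ab k(1), of n] by linarith
      have hi: "?g (Suc k) \<le> t" using j k grid_mono[OF ab, of "Suc k" j n] by simp
      have I: "?I \<subseteq> {a..b}" "?I \<subseteq> {s..t}" using lo hi s t by auto
      have bI: "?g k \<in> {a..b}" "?g (Suc k) \<in> {a..b}" using I len \<delta> by auto
      have int\<beta>: "integral {a..?g k} \<beta> + integral ?I \<beta> = integral {a..?g (Suc k)} \<beta>"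
        using bI len \<delta>
        by (intro Henstock_Kurzweil_Integration.integral_combine integrable_continuous_real
            continuous_on_subset[OF \<beta>]) auto
      have "(f has_real_derivative f' u) (at u within ?I)" if "u \<in> ?I" for u
        using that I(1) by (intro DERIV_subset[OF f I(1)]) blast
      then have intf': "(f' has_integral (f (?g (Suc k)) - f (?g k))) ?I"
        using len \<delta> by (intro fundamental_theorem_of_calculus)
          (simp_all flip: has_real_derivative_iff_has_vector_derivative)
      have "integral ?I (\<lambda>u. f (?g k) * \<beta> u + y (?g (Suc k)) * f' u) \<le> integral ?I (\<lambda>u. \<eta> * (B1 + B2))"
      proof (rule integral_le)
        fix u assume u: "u \<in> ?I"
        then have u': "u \<in> {a..b}" "u \<in> {s..t}" using I by auto
        have "\<bar>f (?g k) - f u\<bar> \<le> \<eta>" "\<bar>y (?g (Suc k)) - y u\<bar> \<le> \<eta>"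
          using elim(1,2) bI u' u len unfolding \<delta>_def[symmetric] by auto
        then have "\<bar>(f (?g k) - f u) * \<beta> u\<bar> \<le> \<eta> * B1" "\<bar>(y (?g (Suc k)) - y u) * f' u\<bar> \<le> \<eta> * B2"
          using B1[OF u'(1)] B2[OF u'(1)] \<eta> by (auto simp: abs_mult intro!: mult_mono)
        moreover have "f u * \<beta> u + f' u * y u \<le> 0" using sgn[OF u'(1)] pos[OF u'(2)] by simp
        ultimately show "f (?g k) * \<beta> u + y (?g (Suc k)) * f' u \<le> \<eta> * (B1 + B2)"
          by (simp add: algebra_simps abs_le_iff)
      qed (auto intro!: integrable_continuous_real continuous_intros continuous_on_subset[OF _ I(1)] \<beta> f')
      moreover have "integral ?I (\<lambda>u. f (?g k) * \<beta> u + y (?g (Suc k)) * f' u)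
          = f (?g k) * integral ?I \<beta> + y (?g (Suc k)) * (f (?g (Suc k)) - f (?g k))"
        using intf' by (subst Henstock_Kurzweil_Integration.integral_add)
          (auto intro!: integrable_continuous_real continuous_intros continuous_on_subset[OF _ I(1)] \<beta> f' simp: integral_unique)
      moreover have "f (?g k) * (y (?g (Suc k)) - y (?g k)) = f (?g k) * integral ?I \<beta> + f (?g k) * (Z (?g (Suc k)) - Z (?g k))"
        using eq[OF bI(1)] eq[OF bI(2)] int\<beta> by (simp flip: distrib_left)
      ultimately show ?thesis using len \<delta> by (simp add: algebra_simps)
    qed
    have "f (?g j) * y (?g j) - f (?g i) * y (?g i)
        \<le> (\<Sum>k\<in>{i..<j}. f (?g k) * (Z (?g (Suc k)) - Z (?g k)) + \<eta> * (B1 + B2) * \<delta>)"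
      unfolding sum_Suc_diff'[OF ij, of "\<lambda>k. f (?g k) * y (?g k)", symmetric]
      by (intro sum_mono step) auto
    also have "\<dots> = (\<Sum>k\<in>{i..<j}. f (?g k) * (Z (?g (Suc k)) - Z (?g k))) + \<eta> * (B1 + B2) * (real (j - i) * \<delta>)"
      by (simp add: sum.distrib)
    also have "\<eta> * (B1 + B2) * (real (j - i) * \<delta>) \<le> \<eta> * (B1 + B2) * (b - a)"
    proof (rule mult_left_mono)
      have "real (j - i) * \<delta> \<le> real n * \<delta>" using jn \<delta> by simp
      then show "real (j - i) * \<delta> \<le> b - a" using elim by (simp add: \<delta>_def)
    qed (use \<eta> B0 in auto)
    finally have "f (?g j) * y (?g j) - f (?g i) * y (?g i) - \<eta> * (B1 + B2) * (b - a)
        \<le> (\<Sum>k\<in>{i..<j}. f (?g k) * (Z (?g (Suc k)) - Z (?g k)))" by simp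
    moreover have "\<bar>f (?g j) * y (?g j) - f t * y t\<bar> \<le> \<eta>"
    proof -
      have "\<bar>?g j - t\<bar> \<le> \<delta>" using j by linarith
      then show ?thesis
        using elim(3) grid_in[OF ab jn elim(4)] t(1) unfolding \<delta>_def by blast
    qed
    moreover have "\<bar>f (?g i) * y (?g i) - f s * y s\<bar> \<le> \<eta>"
    proof -
      have "\<bar>?g i - s\<bar> \<le> \<delta>" using i by linarith
      moreover have "s \<in> {a..b}" using s t by auto
      ultimately show ?thesis
        using elim(3) grid_in[OF ab order_trans[OF ij jn] elim(4)] unfolding \<delta>_def by blast
    qed
    ultimately have "H' \<le> (\<Sum>k\<in>{i..<j}. f (?g k) * (Z (?g (Suc k)) - Z (?g k)))"
      using \<eta>H t s by (simp add: abs_le_iff)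
    then show ?case using ij jn by blast
  qed
qed

section \<open>Exit probabilities for processes driven by Brownian motion\<close>

text \<open>The weighted increments are independent centred Gaussians with variances
  \<open>(c i)\<^sup>2 * \<delta>\<close>. Times are counted from 0 because a path started at
  \<open>a\<close> is driven by \<open>W (t - a)\<close>.\<close>

lemma brownian_motion_prob_killed_reflected_walk:
  assumes W: "brownian_motion M W" and \<delta>: "0 < \<delta>" and H: "0 \<le> H" and l: "0 \<le> l"
  shows "measure M {\<omega>\<in>space M. H \<le> killed_reflected_walk H
             (\<lambda>i. c i * (W (real (Suc i) * \<delta>) \<omega> - W (real i * \<delta>) \<omega>)) n}
         \<le> 2 * exp (l\<^sup>2 * (\<Sum>i<n. (c i)\<^sup>2 * \<delta>) / 2 - l * H)"
proof -
  interpret prob_space M using W by (simp add: brownian_motion_def)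
  \<comment> \<open>\<open>n\<close> increments need \<open>Suc n\<close> times, in accordance with
    \<open>length ts - 1\<close> in \<open>brownian_motion\<close>.\<close>
  define ts where "ts = map (\<lambda>i. real i * \<delta>) [0..<Suc n]"
  have ts: "length ts = Suc n" "\<And>i. i \<le> n \<Longrightarrow> ts ! i = real i * \<delta>"
    by (simp_all add: ts_def del: upt_Suc)
  have "sorted_wrt (<) ts"
    using \<delta> by (simp add: ts sorted_wrt_iff_nth_less)
  moreover have "\<forall>t\<in>set ts. 0 \<le> t" using \<delta> by (auto simp: ts_def)
  ultimately have "indep_vars (\<lambda>_. borel) (\<lambda>i \<omega>. W (ts ! Suc i) \<omega> - W (ts ! i) \<omega>) {..<n}"
    using W ts(1) by (force simp: brownian_motion_def)
  then have "indep_vars (\<lambda>_. borel) (\<lambda>i \<omega>. W (real (Suc i) * \<delta>) \<omega> - W (real i * \<delta>) \<omega>) {..<n}"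
    by (subst (asm) indep_vars_cong[OF refl _ refl]) (auto simp: ts fun_eq_iff)
  then have ind: "indep_vars (\<lambda>_. borel) (\<lambda>i \<omega>. c i * (W (real (Suc i) * \<delta>) \<omega> - W (real i * \<delta>) \<omega>)) {..<n}"
    by (rule indep_vars_compose2) auto
  show ?thesis
  proof (rule prob_killed_reflected_walk[OF ind _ _ H l])
    fix i :: nat and a :: real
    have lt: "real i * \<delta> < real (Suc i) * \<delta>" using \<delta> by simp
    have "distributed M lborel (\<lambda>\<omega>. W (real (Suc i) * \<delta>) \<omega> - W (real i * \<delta>) \<omega>)
        (\<lambda>x. ennreal (normal_density 0 (sqrt \<delta>) x))"
    proof -
      have "0 \<le> real i * \<delta>" "real (Suc i) * \<delta> - real i * \<delta> = \<delta>" using \<delta> by (simp_all add: algebra_simps)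
      with lt show ?thesis
        using W unfolding brownian_motion_def by metis
    qed
    from nn_integral_exp_normal[OF this, of "a * c i"]
    show "(\<integral>\<^sup>+\<omega>. ennreal (exp (a * (c i * (W (real (Suc i) * \<delta>) \<omega> - W (real i * \<delta>) \<omega>)))) \<partial>M)
        \<le> ennreal (exp (a\<^sup>2 * ((c i)\<^sup>2 * \<delta>) / 2))"
      using \<delta> by (simp add: mult.assoc power_mult_distrib)
  qed (use \<delta> in auto)
qed

text \<open>\<open>E'\<close> is the lower limit of the events: an increasing union of tail
  intersections, the \<open>m\<close>-th of which lies in \<open>E m\<close>. It suits paths that
  belong to \<open>E n\<close> from some \<open>n\<close> on, where this \<open>n\<close> depends on
  the path.\<close>

lemma (in prob_space) prob_eventually_le:
  assumes meas: "\<And>n. E n \<in> events" and ev: "\<forall>\<^sub>F n in sequentially. prob (E n) \<le> p"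
    and E: "E' = (\<Union>m. \<Inter>n\<in>{m..}. E n)"
  shows "E' \<in> events" "prob E' \<le> p"
proof -
  let ?F = "\<lambda>m. \<Inter>n\<in>{m..}. E n"
  have F: "?F m \<in> events" for m using meas by (intro sets.countable_INT) auto
  then show "E' \<in> events" unfolding E by (intro sets.countable_UN) auto
  have "(\<lambda>m. prob (?F m)) \<longlonglongrightarrow> prob (\<Union>m. ?F m)"
    using F by (intro finite_Lim_measure_incseq) (auto simp: incseq_def)
  moreover have "\<forall>\<^sub>F m in sequentially. prob (?F m) \<le> p"
    using ev
  proof eventually_elim
    case (elim m)
    have "prob (?F m) \<le> prob (E m)" using meas by (intro finite_measure_mono) auto
    then show ?case using elim by simp
  qed
  ultimately show "prob E' \<le> p" unfolding E
    by (intro tendsto_upperbound) auto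
qed

text \<open>The factor 8 instead of 4 pays for the discretisation error: it leaves room for a threshold
  \<open>H' < H\<close> and for Riemann sums slightly above \<open>V\<close>.\<close>
lemma confined_drift_exit_bound:
  fixes f f' :: "real \<Rightarrow> real" and y \<beta> q :: "real \<Rightarrow> 'a \<Rightarrow> real"
  assumes W: "brownian_motion M W" and ab: "a < b"
    and f: "\<And>t. t \<in> {a..b} \<Longrightarrow> (f has_real_derivative f' t) (at t within {a..b})"
    and f': "continuous_on {a..b} f'"
    and fpos: "\<And>t. t \<in> {a..b} \<Longrightarrow> 0 < f t"
    and y: "\<And>\<omega>. \<omega> \<in> space M \<Longrightarrow> continuous_on {a..b} (\<lambda>t. y t \<omega>)"
    and \<beta>: "\<And>\<omega>. \<omega> \<in> space M \<Longrightarrow> continuous_on {a..b} (\<lambda>t. \<beta> t \<omega>)"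
    and eq: "\<And>\<omega> t. \<omega> \<in> space M \<Longrightarrow> t \<in> {a..b} \<Longrightarrow> y t \<omega> = integral {a..t} (\<lambda>s. \<beta> s \<omega>) + c * W (t - a) \<omega>"
    and drift: "\<And>\<omega> t. \<omega> \<in> space M \<Longrightarrow> t \<in> {a..b} \<Longrightarrow> f t * \<beta> t \<omega> + f' t * y t \<omega> = - (q t \<omega> * y t \<omega>)"
    and q: "\<And>\<omega> t. \<omega> \<in> space M \<Longrightarrow> t \<in> {a..b} \<Longrightarrow> 0 \<le> q t \<omega>"
    and H: "0 < H" and V: "0 < V" "integral {a..b} (\<lambda>s. (c * f s)\<^sup>2) \<le> V"
  shows "\<exists>E\<in>sets M. {\<omega>\<in>space M. \<exists>t\<in>{a..b}. H \<le> f t * \<bar>y t \<omega>\<bar>} \<subseteq> E \<and> measure M E \<le> 8 * exp (- H\<^sup>2 / (2 * V))"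
proof -
  interpret prob_space M using W by (simp add: brownian_motion_def)
  \<comment> \<open>The first entry keeps \<open>H'\<close> nonnegative; the second limits the loss
    \<open>l * (H - H')\<close> to \<open>ln 2 / 2\<close>.\<close>
  define H' where "H' = max (H / 2) (H - V * ln 2 / (2 * H))"
  \<comment> \<open>The minimiser of \<open>l\<^sup>2 * V / 2 - l * H\<close>, with minimum
    \<open>- H\<^sup>2 / (2 * V)\<close>.\<close>
  define l where "l = H / V"
  have l: "0 < l" using H V by (simp add: l_def)
  have H': "0 \<le> H'" "H' < H" using H V by (auto simp: H'_def)
  have "l * (H - H') \<le> l * (V * ln 2 / (2 * H))" 
    using l by (intro mult_left_mono) (auto simp: H'_def)
  also have "\<dots> = ln 2 / 2" using H V by (simp add: l_def)
  finally have lH: "l * H - ln 2 / 2 \<le> l * H'" by (simp add: algebra_simps)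
  have fc: "continuous_on {a..b} f"
    using f DERIV_continuous unfolding continuous_on_eq_continuous_within by blast
  define \<delta> where "\<delta> n = (b - a) / real n" for n
  \<comment> \<open>The sign \<open>r\<close> is 1 for rises of the noise and -1 for falls.\<close>
  define \<xi> where "\<xi> r n i \<omega> = r * c * f (grid a b n i) * (W (real (Suc i) * \<delta> n) \<omega> - W (real i * \<delta> n) \<omega>)"
    for r :: real and n i :: nat and \<omega>
  define A where "A r n = {\<omega>\<in>space M. H' \<le> killed_reflected_walk H' (\<lambda>i. \<xi> r n i \<omega>) n}" for r n
  define E where "E = (\<Union>m. \<Inter>n\<in>{m..}. A 1 n \<union> A (-1) n)"
  have \<delta>: "0 \<le> \<delta> n" for n using ab by (simp add: \<delta>_def)
  have [measurable]: "W t \<in> borel_measurable M" if "0 \<le> t" for t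
    using W that by (auto simp: brownian_motion_def)
  have A: "A r n \<in> events" for r n
  proof -
    have "(\<lambda>\<omega>. killed_reflected_walk H' (\<lambda>i. \<xi> r n i \<omega>) n) \<in> borel_measurable M"
    proof (rule measurable_killed_reflected_walk)
      fix i
      have "W (real (Suc i) * \<delta> n) \<in> borel_measurable M" "W (real i * \<delta> n) \<in> borel_measurable M"
        using \<delta> by auto
      then show "\<xi> r n i \<in> borel_measurable M"
        unfolding \<xi>_def by measurable
    qed
    then show ?thesis unfolding A_def by measurable
  qed
  have "continuous_on {a..b} (\<lambda>s. (c * f s)\<^sup>2)" by (intro continuous_intros fc)
  then have "(\<lambda>n. \<Sum>k<n. (c * f (grid a b n k))\<^sup>2 * \<delta> n) \<longlonglongrightarrow> integral {a..b} (\<lambda>s. (c * f s)\<^sup>2)"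
    unfolding \<delta>_def using ab by (intro Riemann_sum_tendsto) auto
  \<comment> \<open>An excess of \<open>ln 2 / l\<^sup>2\<close> over \<open>V\<close> adds
    \<open>ln 2 / 2\<close> to the exponent, as does the lower threshold \<open>H'\<close>. Together
    they double the factor 2 of the walk estimate, and the two signs double it again.\<close>
  moreover have "integral {a..b} (\<lambda>s. (c * f s)\<^sup>2) < V + ln 2 / l\<^sup>2"
    using V l by (simp add: add_strict_increasing2 add.commute add_pos_nonneg less_add_same_cancel1 order.strict_trans1)
  ultimately have "\<forall>\<^sub>F n in sequentially. (\<Sum>k<n. (c * f (grid a b n k))\<^sup>2 * \<delta> n) < V + ln 2 / l\<^sup>2"
    by (rule order_tendstoD)
  then have "\<forall>\<^sub>F n in sequentially. prob (A 1 n \<union> A (-1) n) \<le> 8 * exp (- H\<^sup>2 / (2 * V))"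
    using eventually_gt_at_top[of 0]
  proof eventually_elim
    case (elim n)
    have "prob (A r n) \<le> 4 * exp (- H\<^sup>2 / (2 * V))" if r: "r\<^sup>2 = 1" for r
    proof -
      have "prob (A r n) \<le> 2 * exp (l\<^sup>2 * (\<Sum>i<n. (r * c * f (grid a b n i))\<^sup>2 * \<delta> n) / 2 - l * H')"
        unfolding A_def \<xi>_def
        using elim ab H' l by (intro brownian_motion_prob_killed_reflected_walk[OF W]) (auto simp: \<delta>_def)
      also have "(\<Sum>i<n. (r * c * f (grid a b n i))\<^sup>2 * \<delta> n) = (\<Sum>k<n. (c * f (grid a b n k))\<^sup>2 * \<delta> n)"
        using r by (simp add: power_mult_distrib)
      also have "2 * exp (l\<^sup>2 * \<dots> / 2 - l * H') \<le> 2 * exp (l\<^sup>2 * (V + ln 2 / l\<^sup>2) / 2 - (l * H - ln 2 / 2))"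
        using elim(1) lH l by (intro mult_left_mono iffD2[OF exp_le_cancel_iff] diff_mono divide_right_mono) auto
      also have "l\<^sup>2 * (V + ln 2 / l\<^sup>2) / 2 - (l * H - ln 2 / 2) = ln 2 + - H\<^sup>2 / (2 * V)"
        using l V H by (simp add: distrib_left) (simp add: l_def field_simps power2_eq_square)
      also have "2 * exp \<dots> = 4 * exp (- H\<^sup>2 / (2 * V))" by (simp only: exp_add) simp
      finally show ?thesis .
    qed
    from this[of 1] this[of "-1"] show ?case
      using measure_Un_le[OF A[of 1 n] A[of "-1" n]] by simp
  qed
  from prob_eventually_le[OF _ this E_def] A have E: "E \<in> events" "prob E \<le> 8 * exp (- H\<^sup>2 / (2 * V))"
    by auto
  have "\<omega> \<in> E" if \<omega>: "\<omega> \<in> space M" and t: "t \<in> {a..b}" "H \<le> f t * \<bar>y t \<omega>\<bar>" for \<omega> t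
  proof -
    define r :: real where "r = (if 0 \<le> y t \<omega> then 1 else -1)"
    have r: "r = 1 \<or> r = -1" "r * r = 1" "r * y t \<omega> = \<bar>y t \<omega>\<bar>" by (auto simp: r_def)
    have "W 0 \<omega> = 0" using W \<omega> by (simp add: brownian_motion_def)
    then have ya: "y a \<omega> = 0" using eq[OF \<omega>, of a] ab by simp
    have "\<forall>\<^sub>F n in sequentially. \<exists>i j. i \<le> j \<and> j \<le> n \<and>
           H' \<le> (\<Sum>k\<in>{i..<j}. f (grid a b n k) * (r * c * W (grid a b n (Suc k) - a) \<omega> - r * c * W (grid a b n k - a) \<omega>))"
    proof (rule eventually_Riemann_sum_rise[OF f f' _ _ fpos _ _ _ t(1) _ H'])
      fix s assume s: "s \<in> {a..b}" 
      show "r * y s \<omega> = integral {a..s} (\<lambda>s. r * \<beta> s \<omega>) + r * c * W (s - a) \<omega>"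
        using eq[OF \<omega> s] by (simp add: distrib_left)
      assume pos: "0 \<le> r * y s \<omega>"
      have "f s * (r * \<beta> s \<omega>) + f' s * (r * y s \<omega>) = r * (f s * \<beta> s \<omega> + f' s * y s \<omega>)"
        by (simp add: algebra_simps)
      also have "\<dots> = - (q s \<omega> * (r * y s \<omega>))" using drift[OF \<omega> s] by simp
      also have "\<dots> \<le> 0" using q[OF \<omega> s] pos by simp
      finally show "f s * (r * \<beta> s \<omega>) + f' s * (r * y s \<omega>) \<le> 0" .
    qed (use y[OF \<omega>] \<beta>[OF \<omega>] ya r t in \<open>auto intro!: continuous_intros\<close>)
    then have "\<forall>\<^sub>F n in sequentially. \<omega> \<in> A r n"
      using eventually_gt_at_top[of 0]
    proof eventually_elim
      case (elim n)
      then obtain i j where ij: "i \<le> j" "j \<le> n"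
        and le: "H' \<le> (\<Sum>k\<in>{i..<j}. f (grid a b n k) * (r * c * W (grid a b n (Suc k) - a) \<omega> - r * c * W (grid a b n k - a) \<omega>))"
        by blast
      have "H' \<le> (\<Sum>k\<in>{i..<j}. \<xi> r n k \<omega>)"
        using le by (simp add: \<xi>_def \<delta>_def grid_def algebra_simps)
      from killed_reflected_walk_ge[OF ij this] \<omega> show ?case by (simp add: A_def)
    qed
    then have "\<forall>\<^sub>F n in sequentially. \<omega> \<in> A 1 n \<union> A (-1) n"
      by eventually_elim (use r in auto)
    then show "\<omega> \<in> E" by (auto simp: E_def eventually_sequentially)
  qed
  then show ?thesis using E by blast
qed

text \<open>While \<open>G k \<le> g t < G (Suc k)\<close>, the moving barrier is at least
  \<open>h * sqrt (G k)\<close> and the accumulated variance at most \<open>G (Suc k)\<close>. Their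
  ratio yields the exponent \<open>h\<^sup>2 * exp (- \<Delta>) / 2\<close>, and
  \<open>exp (- \<Delta>) \<ge> 1 - \<Delta>\<close>. A measurable cover \<open>E\<close> is
  asserted because the exit set itself need not be measurable.\<close>

lemma confined_drift_exit_variance_scaled:
  fixes f f' :: "real \<Rightarrow> real" and y \<beta> q :: "real \<Rightarrow> 'a \<Rightarrow> real"
  assumes W: "brownian_motion M W" and ab: "a < b"
    and f: "\<And>t. t \<in> {a..b} \<Longrightarrow> (f has_real_derivative f' t) (at t within {a..b})"
    and f': "continuous_on {a..b} f'"
    and fpos: "\<And>t. t \<in> {a..b} \<Longrightarrow> 0 < f t"
    and y: "\<And>\<omega>. \<omega> \<in> space M \<Longrightarrow> continuous_on {a..b} (\<lambda>t. y t \<omega>)"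
    and \<beta>: "\<And>\<omega>. \<omega> \<in> space M \<Longrightarrow> continuous_on {a..b} (\<lambda>t. \<beta> t \<omega>)"
    and eq: "\<And>\<omega> t. \<omega> \<in> space M \<Longrightarrow> t \<in> {a..b} \<Longrightarrow> y t \<omega> = integral {a..t} (\<lambda>s. \<beta> s \<omega>) + c * W (t - a) \<omega>"
    and drift: "\<And>\<omega> t. \<omega> \<in> space M \<Longrightarrow> t \<in> {a..b} \<Longrightarrow> f t * \<beta> t \<omega> + f' t * y t \<omega> = - (q t \<omega> * y t \<omega>)"
    and q: "\<And>\<omega> t. \<omega> \<in> space M \<Longrightarrow> t \<in> {a..b} \<Longrightarrow> 0 \<le> q t \<omega>"
    and g: "\<And>t. g t = v0 + integral {a..t} (\<lambda>s. (c * f s)\<^sup>2)"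
    and pos: "0 < h" "0 < v0" "0 < \<Delta>" and gb: "g b < v0 * exp (real n * \<Delta>)"
  shows "\<exists>E\<in>sets M. {\<omega>\<in>space M. \<exists>t\<in>{a..b}. h * sqrt (g t) \<le> f t * \<bar>y t \<omega>\<bar>} \<subseteq> E
            \<and> measure M E \<le> 8 * real n * exp (- (1 - \<Delta>) * h\<^sup>2 / 2)"
proof -
  interpret prob_space M using W by (simp add: brownian_motion_def)
  define G where "G k = v0 * exp (real k * \<Delta>)" for k :: nat
  have Gpos: "0 < G k" for k using pos by (simp add: G_def)
  have fc: "continuous_on {a..b} f"
    using f DERIV_continuous unfolding continuous_on_eq_continuous_within by blast
  have cf: "continuous_on {a..b} (\<lambda>s. (c * f s)\<^sup>2)" by (intro continuous_intros fc)
  have int: "(\<lambda>s. (c * f s)\<^sup>2) integrable_on {u..v}" if "a \<le> u" "v \<le> b" for u v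
    using that by (intro integrable_continuous_real continuous_on_subset[OF cf]) auto
  have gc: "continuous_on {a..b} g"
    unfolding g using int by (intro continuous_intros indefinite_integral_continuous_1) auto
  have gmono: "g s \<le> g t" if "a \<le> s" "s \<le> t" "t \<le> b" for s t
    unfolding g using that int by (intro add_left_mono integral_subset_le) auto
  have "\<exists>E\<in>sets M. {\<omega>\<in>space M. \<exists>t\<in>{a..b}. G k \<le> g t \<and> g t < G (Suc k) \<and> h * sqrt (g t) \<le> f t * \<bar>y t \<omega>\<bar>} \<subseteq> E
            \<and> measure M E \<le> 8 * exp (- (1 - \<Delta>) * h\<^sup>2 / 2)" for k
  proof -
    have "v0 < G (Suc k)"
      using pos by (simp add: G_def add_pos_nonneg)
    then have ga: "g a < G (Suc k)" by (simp add: g)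
    \<comment> \<open>All times of level \<open>k\<close> lie before or at \<open>T\<close>, and
      \<open>g\<close> has not passed \<open>G (Suc k)\<close> there. The estimate is applied on all
      of \<open>{a..T}\<close>, where the process starts from 0, so no restart at an intermediate
      time is involved.\<close>
    obtain T where T: "a < T" "T \<le> b" "g T \<le> G (Suc k)" "\<And>t. t \<in> {a..b} \<Longrightarrow> g t < G (Suc k) \<Longrightarrow> t \<le> T"
    proof (cases "g b \<le> G (Suc k)")
      case True
      then show ?thesis using that[of b] ab by auto
    next
      case False
      then obtain T where T: "a \<le> T" "T \<le> b" "g T = G (Suc k)"
        using IVT'[of g a "G (Suc k)" b] ga gc ab by auto
      then have "a \<noteq> T" using ga by auto
      moreover have "t \<le> T" if "t \<in> {a..b}" "g t < G (Suc k)" for t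
        using gmono[of T t] T that by (cases "t \<le> T") auto
      ultimately show ?thesis using that[of T] T by auto
    qed
    have sub: "{a..T} \<subseteq> {a..b}" using T by auto
    have V: "integral {a..T} (\<lambda>s. (c * f s)\<^sup>2) \<le> G (Suc k)"
      using T(3) pos by (simp add: g)
    have H: "0 < h * sqrt (G k)" using pos Gpos by simp
    have "\<exists>E\<in>sets M. {\<omega>\<in>space M. \<exists>t\<in>{a..T}. h * sqrt (G k) \<le> f t * \<bar>y t \<omega>\<bar>} \<subseteq> E
       \<and> measure M E \<le> 8 * exp (- (h * sqrt (G k))\<^sup>2 / (2 * G (Suc k)))"
    proof (rule confined_drift_exit_bound[where f'=f' and \<beta>=\<beta> and q=q, OF W T(1) _ _ _ _ _ _ _ _ H Gpos V])
      fix t assume "t \<in> {a..T}"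
      then have t: "t \<in> {a..b}" using sub by blast
      show "(f has_real_derivative f' t) (at t within {a..T})" by (rule DERIV_subset[OF f[OF t] sub])
      show "0 < f t" by (rule fpos[OF t])
      fix \<omega> assume \<omega>: "\<omega> \<in> space M"
      show "y t \<omega> = integral {a..t} (\<lambda>s. \<beta> s \<omega>) + c * W (t - a) \<omega>" by (rule eq[OF \<omega> t])
      show "f t * \<beta> t \<omega> + f' t * y t \<omega> = - (q t \<omega> * y t \<omega>)" by (rule drift[OF \<omega> t])
      show "0 \<le> q t \<omega>" by (rule q[OF \<omega> t])
    qed (rule continuous_on_subset[OF f' sub] continuous_on_subset[OF y sub]
          continuous_on_subset[OF \<beta> sub], assumption?)+
    then obtain E where E: "E \<in> sets M" "{\<omega>\<in>space M. \<exists>t\<in>{a..T}. h * sqrt (G k) \<le> f t * \<bar>y t \<omega>\<bar>} \<subseteq> E"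
      "measure M E \<le> 8 * exp (- (h * sqrt (G k))\<^sup>2 / (2 * G (Suc k)))" by blast
    have "- (h * sqrt (G k))\<^sup>2 / (2 * G (Suc k)) = - (h\<^sup>2 * exp (- \<Delta>) / 2)"
    proof -
      have "G (Suc k) = G k / exp (- \<Delta>)"
        by (simp add: G_def distrib_right exp_add exp_minus divide_inverse)
      then show ?thesis using Gpos[of k] by (simp add: power_mult_distrib)
    qed
    also have "\<dots> \<le> - (1 - \<Delta>) * h\<^sup>2 / 2"
      using mult_right_mono[OF exp_ge_add_one_self[of "- \<Delta>"], of "h\<^sup>2"] by (simp add: algebra_simps)
    finally have "- (h * sqrt (G k))\<^sup>2 / (2 * G (Suc k)) \<le> - (1 - \<Delta>) * h\<^sup>2 / 2" .
    then have "measure M E \<le> 8 * exp (- (1 - \<Delta>) * h\<^sup>2 / 2)"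
      by (intro order_trans[OF E(3)] mult_left_mono iffD2[OF exp_le_cancel_iff]) auto
    moreover have "{\<omega>\<in>space M. \<exists>t\<in>{a..b}. G k \<le> g t \<and> g t < G (Suc k) \<and> h * sqrt (g t) \<le> f t * \<bar>y t \<omega>\<bar>}
        \<subseteq> {\<omega>\<in>space M. \<exists>t\<in>{a..T}. h * sqrt (G k) \<le> f t * \<bar>y t \<omega>\<bar>}"
    proof safe
      fix \<omega> t assume t: "t \<in> {a..b}" "G k \<le> g t" "g t < G (Suc k)" "h * sqrt (g t) \<le> f t * \<bar>y t \<omega>\<bar>"
      have "h * sqrt (G k) \<le> h * sqrt (g t)" using pos t by (intro mult_left_mono) auto
      then show "\<exists>t\<in>{a..T}. h * sqrt (G k) \<le> f t * \<bar>y t \<omega>\<bar>"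
        using t T(4)[of t] by (intro bexI[of _ t]) auto
    qed
    ultimately show ?thesis using E(1,2) by (intro bexI[of _ E] conjI subset_trans[OF _ E(2)])
  qed
  then have "\<exists>E. \<forall>k. E k \<in> sets M \<and>
      {\<omega>\<in>space M. \<exists>t\<in>{a..b}. G k \<le> g t \<and> g t < G (Suc k) \<and> h * sqrt (g t) \<le> f t * \<bar>y t \<omega>\<bar>} \<subseteq> E k \<and>
      measure M (E k) \<le> 8 * exp (- (1 - \<Delta>) * h\<^sup>2 / 2)"
    by (intro choice) (simp add: Bex_def)
  then obtain E where E: "\<And>k. E k \<in> sets M"
    "\<And>k. {\<omega>\<in>space M. \<exists>t\<in>{a..b}. G k \<le> g t \<and> g t < G (Suc k) \<and> h * sqrt (g t) \<le> f t * \<bar>y t \<omega>\<bar>} \<subseteq> E k"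
    "\<And>k. measure M (E k) \<le> 8 * exp (- (1 - \<Delta>) * h\<^sup>2 / 2)"
    by blast
  show ?thesis
  proof (intro bexI[of _ "\<Union>k<n. E k"] conjI)
    show "{\<omega>\<in>space M. \<exists>t\<in>{a..b}. h * sqrt (g t) \<le> f t * \<bar>y t \<omega>\<bar>} \<subseteq> (\<Union>k<n. E k)"
    proof safe
      fix \<omega> t assume \<omega>: "\<omega> \<in> space M" and t: "t \<in> {a..b}" "h * sqrt (g t) \<le> f t * \<bar>y t \<omega>\<bar>"
      have "g t < G n" using gmono[of t b] t gb by (simp add: G_def)
      moreover have "\<not> g t < G 0" using gmono[of a t] t by (simp add: G_def g not_less)
      ultimately obtain k where "k < n" "\<not> g t < G k" "g t < G (Suc k)"
        using ex_least_nat_less[of "\<lambda>k. g t < G k" n] by auto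
      then have "\<omega> \<in> E k" using \<omega> t
        by (intro subsetD[OF E(2)] CollectI conjI[OF \<omega>] bexI[OF _ t(1)]) auto
      then show "\<omega> \<in> (\<Union>k<n. E k)" using \<open>k < n\<close> by blast
    qed
    have "measure M (\<Union>k<n. E k) \<le> (\<Sum>k<n. measure M (E k))"
      using E(1) by (intro finite_measure_subadditive_finite) auto
    also have "\<dots> \<le> (\<Sum>k<n. 8 * exp (- (1 - \<Delta>) * h\<^sup>2 / 2))"
      by (intro sum_mono E(3))
    finally show "measure M (\<Union>k<n. E k) \<le> 8 * real n * exp (- (1 - \<Delta>) * h\<^sup>2 / 2)"
      by (simp add: mult.commute mult.left_commute)
  qed (use E(1) in auto)
qed

section \<open>The functions \<open>alpha\<close> and \<open>vbar\<close>, and the counting of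
  levels\<close>

lemma alpha_has_real_derivative:
  assumes "continuous_on {a..b} \<mu>" "t \<in> {a..b}"
  shows "((\<lambda>t. alpha \<mu> t a) has_real_derivative \<mu> t) (at t within {a..b})"
  unfolding alpha_def by (rule integral_has_real_derivative[OF assms])

text \<open>Additivity of \<open>alpha\<close> takes the growth factor out of the integral. Thus
  \<open>vbar\<close> is \<open>g / f\<^sup>2\<close> for the increasing \<open>g\<close> and the
  \<open>f\<close> of the exit estimate, and leaving the tube means
  \<open>f * \<bar>y\<bar> \<ge> h * sqrt g\<close>.\<close>

lemma vbar_eq:
  assumes \<mu>: "continuous_on {a..t} \<mu>" and t: "a \<le> t" and \<epsilon>: "0 < \<epsilon>"
  shows "vbar \<mu> \<epsilon> \<sigma> a v0 t = (exp (alpha \<mu> t a / \<epsilon>))\<^sup>2 *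
           (v0 + integral {a..t} (\<lambda>s. (\<sigma> / sqrt \<epsilon> * exp (- alpha \<mu> s a / \<epsilon>))\<^sup>2))"
proof -
  have "integral {a..t} (\<lambda>s. exp (2 * alpha \<mu> t s / \<epsilon>))
      = integral {a..t} (\<lambda>s. (exp (alpha \<mu> t a / \<epsilon>))\<^sup>2 * (exp (- alpha \<mu> s a / \<epsilon>))\<^sup>2)"
  proof (rule integral_cong)
    fix s assume s: "s \<in> {a..t}"
    then have "alpha \<mu> s a + alpha \<mu> t s = alpha \<mu> t a"
      unfolding alpha_def
      by (intro Henstock_Kurzweil_Integration.integral_combine integrable_continuous_real \<mu>) auto
    then have "2 * alpha \<mu> t s / \<epsilon> = 2 * (alpha \<mu> t a / \<epsilon>) + 2 * (- alpha \<mu> s a / \<epsilon>)"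
      by (simp add: diff_divide_distrib[symmetric] add_divide_distrib[symmetric])
    then show "exp (2 * alpha \<mu> t s / \<epsilon>) = (exp (alpha \<mu> t a / \<epsilon>))\<^sup>2 * (exp (- alpha \<mu> s a / \<epsilon>))\<^sup>2"
      by (simp only: exp_add exp_double)
  qed
  then show ?thesis
    using \<epsilon> exp_double[of "alpha \<mu> t a / \<epsilon>"]
    by (simp add: vbar_def power_mult_distrib power_divide distrib_left mult_ac)
qed

lemma exit_time_Bset_less:
  assumes "exit_time (Bset \<mu> \<epsilon> \<sigma> t1 v0 xd h) t1 X \<omega> < sqrt \<epsilon>"
  shows "\<exists>t\<in>{t1..sqrt \<epsilon>}. h * sqrt (vbar \<mu> \<epsilon> \<sigma> t1 v0 t) \<le> \<bar>X t \<omega> - xd t\<bar>"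
proof -
  let ?S = "{t. t1 \<le> t \<and> (X t \<omega>, t) \<notin> Bset \<mu> \<epsilon> \<sigma> t1 v0 xd h}"
  \<comment> \<open>\<open>Bset\<close> ends at \<open>sqrt \<epsilon>\<close>, so every later time
    lies outside it. Hence \<open>Inf\<close> is taken over a nonempty set, and an infimum below
    \<open>sqrt \<epsilon>\<close> yields an actual time in that set below
    \<open>sqrt \<epsilon>\<close>.\<close>
  have "max t1 (sqrt \<epsilon> + 1) \<in> ?S" by (simp add: Bset_def)
  then have "?S \<noteq> {}" by blast
  from cInf_lessD[OF this assms[unfolded exit_time_def]] obtain t where "t \<in> ?S" "t < sqrt \<epsilon>" by blast
  then show ?thesis by (intro bexI[of _ t]) (auto simp: Bset_def)
qed

text \<open>By \<open>1 + z \<le> exp z\<close>, the logarithm of \<open>x / v0\<close> is at most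
  \<open>u\<close>, which is of order \<open>1 / \<epsilon>\<close>. Steps of width
  \<open>sqrt \<epsilon>\<close> cover it in a multiple of
  \<open>sqrt \<epsilon> / \<epsilon>\<^sup>2\<close> levels; the spare
  \<open>sqrt \<epsilon>\<close> later absorbs constants.\<close>

lemma ex_levels:
  fixes v0 \<epsilon> m L x :: real
  assumes "0 < v0" "0 < \<epsilon>" "\<epsilon> \<le> 1" "0 \<le> m" "0 \<le> L" "x \<le> v0 + L * exp (2 * m * L / \<epsilon>)"
  shows "\<exists>n::nat. x < v0 * exp (real n * sqrt \<epsilon>) \<and> real n \<le> (L / v0 + 2 * m * L + 1) * sqrt \<epsilon> / \<epsilon>\<^sup>2"
proof -
  define u where "u = L / v0 + 2 * m * L / \<epsilon>"
  \<comment> \<open>The added 1 makes \<open>u / sqrt \<epsilon> < real n\<close> strict.\<close>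
  define n where "n = nat \<lfloor>u / sqrt \<epsilon>\<rfloor> + 1"
  have u: "0 \<le> u" using assms by (simp add: u_def)
  have r: "0 < sqrt \<epsilon>" "sqrt \<epsilon> \<le> 1" "sqrt \<epsilon> * sqrt \<epsilon> = \<epsilon>" using assms by auto
  have n: "u / sqrt \<epsilon> < real n" "real n \<le> u / sqrt \<epsilon> + 1"
    using u r by (simp_all add: n_def) linarith
  have "x \<le> v0 * exp (2 * m * L / \<epsilon>) + L * exp (2 * m * L / \<epsilon>)"
    using assms by (intro order_trans[OF assms(6)] add_right_mono) (simp add: mult_le_cancel_left1)
  also have "\<dots> = v0 * ((1 + L / v0) * exp (2 * m * L / \<epsilon>))"
    using assms by (simp add: field_simps)
  also have "\<dots> \<le> v0 * (exp (L / v0) * exp (2 * m * L / \<epsilon>))"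
    using assms by (intro mult_left_mono mult_right_mono exp_ge_add_one_self) auto
  also have "\<dots> = v0 * exp u" by (simp add: u_def exp_add)
  also have "\<dots> < v0 * exp (real n * sqrt \<epsilon>)"
    using n r assms by (simp add: pos_divide_less_eq)
  finally have x: "x < v0 * exp (real n * sqrt \<epsilon>)" .
  have "1 \<le> 1 / \<epsilon>" using assms by simp
  then have "u \<le> (L / v0 + 2 * m * L) / \<epsilon>"
    using assms mult_left_mono[of 1 "1 / \<epsilon>" "L / v0"] by (simp add: u_def add_divide_distrib)
  then have "u / sqrt \<epsilon> \<le> (L / v0 + 2 * m * L) / \<epsilon> / sqrt \<epsilon>"
    using r by (intro divide_right_mono) auto
  moreover have "1 \<le> 1 / \<epsilon> / sqrt \<epsilon>"
    using assms r by (simp add: mult_le_one)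
  ultimately have "real n \<le> (L / v0 + 2 * m * L) / \<epsilon> / sqrt \<epsilon> + 1 / \<epsilon> / sqrt \<epsilon>"
    using n by linarith
  also have "\<dots> = (L / v0 + 2 * m * L + 1) * (1 / \<epsilon> / sqrt \<epsilon>)"
    by (simp add: algebra_simps add_divide_distrib)
  also have "1 / \<epsilon> / sqrt \<epsilon> = sqrt \<epsilon> / \<epsilon>\<^sup>2"
    using r assms by (simp add: frac_eq_eq power2_eq_square)
  finally show ?thesis using x by auto
qed

text \<open>Monotonicity and \<open>\<mu> 0 = 0\<close> give \<open>\<mu> \<le> 0\<close> to the
  left of 0. Monotonicity is weak here, so strictness comes from the linear term of
  \<open>\<mu>\<close>, which makes it negative at a point \<open>u\<close> close to 0; a continuous
  nonpositive function with a negative value has negative integral.\<close>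

lemma alpha_neg_at_bifurcation:
  assumes \<mu>: "continuous_on {t0..T} \<mu>" "mono_on {t0..T} \<mu>"
    and K: "\<forall>t\<in>{t0..T}. \<bar>\<mu> t - t\<bar> \<le> K * t\<^sup>2"
    and t: "t0 \<le> t1" "t1 < 0" "0 < T"
  shows "alpha \<mu> 0 t1 < 0"
proof -
  have "\<mu> 0 = 0" using K t by (auto dest: bspec[of _ _ 0])
  then have neg: "\<mu> s \<le> 0" if "s \<in> {t1..0}" for s
    using mono_onD[OF \<mu>(2), of s 0] that t by auto
  \<comment> \<open>So close to 0, the quadratic error is at most half of \<open>- u\<close>;
    \<open>max K 1\<close> guards against a nonpositive \<open>K\<close>, and \<open>max t1\<close>
    keeps \<open>u\<close> in the interval.\<close>
  define u where "u = max t1 (- 1 / (2 * max K 1))"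
  have u: "t1 \<le> u" "u < 0" "- u * max K 1 \<le> 1 / 2"
    using t by (auto simp: u_def max_def field_simps)
  have "\<mu> u - u \<le> K * u\<^sup>2" using K u t by (auto dest!: bspec[of _ _ u])
  also have "\<dots> \<le> max K 1 * u\<^sup>2" by (intro mult_right_mono) auto
  also have "\<dots> = (- u) * (- u * max K 1)" by (simp add: power2_eq_square)
  also have "\<dots> \<le> (- u) * (1 / 2)" using u by (intro mult_left_mono) auto
  finally have "\<mu> u < 0" using u by simp
  moreover have c: "continuous_on {t1..0} (\<lambda>s. - \<mu> s)"
    using t by (intro continuous_intros continuous_on_subset[OF \<mu>(1)]) auto
  ultimately have "integral {t1..0} (\<lambda>s. - \<mu> s) \<noteq> 0"
    using integral_eq_0_iff[OF c] t neg u by force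
  moreover have "0 \<le> integral {t1..0} (\<lambda>s. - \<mu> s)"
    using neg by (intro Henstock_Kurzweil_Integration.integral_nonneg integrable_continuous_real c) auto
  ultimately show ?thesis by (simp add: alpha_def)
qed

lemma abs_alpha_le:
  assumes "continuous_on {t0..T} \<mu>" "\<And>s. s \<in> {t0..T} \<Longrightarrow> \<bar>\<mu> s\<bar> \<le> m" "t0 \<le> s" "s \<le> t" "t \<le> T"
  shows "\<bar>alpha \<mu> t s\<bar> \<le> m * (t - s)"
proof -
  have "norm (integral {s..t} \<mu>) \<le> m * (t - s)"
    using assms by (intro integral_bound continuous_on_subset[OF assms(1)]) auto
  then show ?thesis by (simp add: alpha_def)
qed

section \<open>The exit estimate for the pitchfork bifurcation\<close>

theorem theorem5p1:
  fixes \<mu> :: "real \<Rightarrow> real" and t0 T t1 x0 v0 :: real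
  assumes "t0 < 0" and "0 < T"
    and "continuous_on {t0..T} \<mu>"
    and "mono_on {t0..T} \<mu>"
    and "\<exists>K. \<forall>t\<in>{t0..T}. \<bar>\<mu> t - t\<bar> \<le> K * t\<^sup>2"
    and "t0 \<le> t1" and "t1 < 0"
    and "0 < x0" and "0 < v0"
  shows "\<exists>h0>0. \<exists>\<epsilon>0>0. \<exists>K1 K2 K3::real.
    \<forall>\<epsilon> \<sigma> h. 0 < \<epsilon> \<and> \<epsilon> \<le> \<epsilon>0 \<and> 0 < \<sigma> \<and> 0 < h \<and> h \<le> h0 * sqrt \<epsilon> / \<sigma> \<longrightarrow>
    (\<forall>(M::'a measure) W X xd.
       brownian_motion M W \<and> det_solution \<mu> \<epsilon> t0 T x0 xd \<and>
       sde_solution M W \<mu> \<epsilon> \<sigma> t1 (sqrt \<epsilon>) (xd t1) X \<longrightarrow>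
       measure M {\<omega>\<in>space M.
          exit_time (Bset \<mu> \<epsilon> \<sigma> t1 v0 xd h) t1 X \<omega> < sqrt \<epsilon>}
       \<le> (\<bar>alpha \<mu> (sqrt \<epsilon>) t1\<bar> + K1 * \<epsilon>) / \<epsilon>\<^sup>2
          * exp (- (1/2 - K2 * sqrt \<epsilon> - K3 * \<sigma>\<^sup>2 * h\<^sup>2 / \<epsilon>) * h\<^sup>2))"
proof -
  note \<mu> = \<open>continuous_on {t0..T} \<mu>\<close>
  obtain m where m: "0 \<le> m" "\<And>s. s \<in> {t0..T} \<Longrightarrow> \<bar>\<mu> s\<bar> \<le> m"
    by (rule continuous_on_compact_bound[OF compact_Icc \<mu>]) auto
  define L where "L = T - t0"
  define a0 where "a0 = - alpha \<mu> 0 t1 / 2"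
  define C where "C = L / v0 + 2 * m * L + 1"
  \<comment> \<open>The bound for \<open>sqrt \<epsilon>\<close>. In turn the entries ensure
    \<open>\<epsilon> \<le> sqrt \<epsilon>\<close>, keep \<open>sqrt \<epsilon>\<close> in the time
    interval, let \<open>8 * C * sqrt \<epsilon>\<close> stay below \<open>a0\<close>, make the
    claim trivial for \<open>h < 1\<close>, and bound \<open>alpha\<close> from 0 to
    \<open>sqrt \<epsilon>\<close> by \<open>a0\<close>.\<close>
  define r0 where "r0 = Min {1, T, a0 / (8 * C), a0 / 2, a0 / (m + 1)}"
  have L: "0 \<le> L" using assms by (simp add: L_def)
  have a0: "0 < a0"
    using alpha_neg_at_bifurcation[OF \<mu> assms(4)] assms by (auto simp: a0_def)
  have C: "1 \<le> C" using L m assms by (simp add: C_def)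
  have r0: "0 < r0" using a0 C m assms by (simp add: r0_def)
  have r0': "r0 \<le> 1" "r0 \<le> T" "r0 \<le> a0 / (8 * C)" "r0 \<le> a0 / 2" "r0 \<le> a0 / (m + 1)"
    unfolding r0_def by (rule Min_le; simp)+
  have main: "measure M {\<omega>\<in>space M. exit_time (Bset \<mu> \<epsilon> \<sigma> t1 v0 xd h) t1 X \<omega> < sqrt \<epsilon>}
       \<le> \<bar>alpha \<mu> (sqrt \<epsilon>) t1\<bar> / \<epsilon>\<^sup>2 * exp (- (1 - sqrt \<epsilon>) * h\<^sup>2 / 2)"
    if \<epsilon>: "0 < \<epsilon>" "\<epsilon> \<le> r0\<^sup>2" and \<sigma>: "0 < \<sigma>" and h: "0 < h" "h \<le> sqrt \<epsilon> / \<sigma>"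
      and W: "brownian_motion M W" and det: "det_solution \<mu> \<epsilon> t0 T x0 xd"
      and sde: "sde_solution M W \<mu> \<epsilon> \<sigma> t1 (sqrt \<epsilon>) (xd t1) X"
    for \<epsilon> \<sigma> h :: real and M :: "'a measure" and W X xd
  proof -
    interpret prob_space M using W by (simp add: brownian_motion_def)
    define b where "b = sqrt \<epsilon>"
    have b: "0 < b" "b \<le> r0" using \<epsilon> r0 real_sqrt_le_mono[OF \<epsilon>(2)] by (simp_all add: b_def)
    have \<epsilon>b: "\<epsilon> = b * b" using \<epsilon> by (simp add: b_def)
    have bT: "b \<le> T" and b1: "b \<le> 1" using b r0' by auto
    have \<epsilon>1: "\<epsilon> \<le> 1" "\<epsilon> \<le> b" using b b1 mult_mono[of b 1 b 1] mult_left_mono[of b 1 b] by (simp_all add: \<epsilon>b)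
    have sub: "{t1..b} \<subseteq> {t0..T}" using assms bT by auto
    have \<mu>': "continuous_on {t1..b} \<mu>" using \<mu> sub by (rule continuous_on_subset)
    \<comment> \<open>The part of the integral before 0 equals \<open>- 2 * a0\<close>, and the part
      after 0 can cancel at most \<open>a0\<close> of it.\<close>
    have \<alpha>: "a0 \<le> \<bar>alpha \<mu> b t1\<bar>"
    proof -
      have "alpha \<mu> 0 t1 + alpha \<mu> b 0 = alpha \<mu> b t1"
        unfolding alpha_def using assms b
        by (intro Henstock_Kurzweil_Integration.integral_combine integrable_continuous_real \<mu>') auto
      moreover have "\<bar>alpha \<mu> b 0\<bar> \<le> a0"
      proof -
        have "\<bar>alpha \<mu> b 0\<bar> \<le> m * (b - 0)"
          using assms b bT m by (intro abs_alpha_le[OF \<mu>]) auto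
        also have "\<dots> \<le> (m + 1) * (a0 / (m + 1))"
          using b r0' m by (intro mult_mono) auto
        also have "\<dots> = a0" using m by simp
        finally show ?thesis .
      qed
      moreover have "alpha \<mu> 0 t1 = - 2 * a0" by (simp add: a0_def)
      ultimately show ?thesis using a0 by linarith
    qed
    \<comment> \<open>For \<open>h < 1\<close> the right-hand side is at least 1. For
      \<open>h \<ge> 1\<close> the hypothesis on \<open>h\<close> forces
      \<open>\<sigma> \<le> sqrt \<epsilon>\<close>, which makes the number of levels independent of
      \<open>\<sigma>\<close>.\<close>
    show ?thesis
    proof (cases "h < 1")
      case True
      have "h\<^sup>2 \<le> 1" using True h by (simp add: power_le_one)
      then have "(1 - b) * h\<^sup>2 \<le> 1 * 1" using b b1 by (intro mult_mono) auto
      then have "exp (- (1 / 2)) \<le> exp (- (1 - b) * h\<^sup>2 / 2)" by (simp add: algebra_simps)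
      moreover have "1 / 2 \<le> exp (- (1 / 2) :: real)" using exp_ge_add_one_self[of "- (1 / 2)"] by simp
      ultimately have "1 / 2 \<le> exp (- (1 - b) * h\<^sup>2 / 2)" by (rule order_trans[rotated])
      moreover have "2 \<le> \<bar>alpha \<mu> b t1\<bar> / \<epsilon>\<^sup>2"
      proof -
        have "\<epsilon>\<^sup>2 \<le> \<epsilon>" using \<epsilon> \<epsilon>1 by (simp add: power2_eq_square mult_left_le)
        also have "\<dots> \<le> a0 / 2" using b r0' \<epsilon>1 by linarith
        finally show ?thesis using \<alpha> \<epsilon> by (simp add: le_divide_eq)
      qed
      ultimately have "2 * (1 / 2) \<le> \<bar>alpha \<mu> b t1\<bar> / \<epsilon>\<^sup>2 * exp (- (1 - b) * h\<^sup>2 / 2)"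
        by (intro mult_mono) auto
      then show ?thesis unfolding b_def[symmetric] by (intro order_trans[OF prob_le_1]) simp
    next
      case False
      define f where "f t = exp (- alpha \<mu> t t1 / \<epsilon>)" for t
      define g where "g t = v0 + integral {t1..t} (\<lambda>s. (\<sigma> / b * f s)\<^sup>2)" for t
      have fpos: "0 < f t" for t by (simp add: f_def)
      have f': "(f has_real_derivative - (\<mu> t / \<epsilon>) * f t) (at t within {t1..b})" if "t \<in> {t1..b}" for t
        unfolding f_def using \<epsilon>
        by (auto intro!: derivative_eq_intros alpha_has_real_derivative[OF \<mu>' that])
      then have fc: "continuous_on {t1..b} f"
        using DERIV_continuous unfolding continuous_on_eq_continuous_within by blast
      have xd': "(xd has_real_derivative (\<mu> t * xd t - (xd t)^3) / \<epsilon>) (at t within {t1..b})" if "t \<in> {t1..b}" for t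
        using det that sub by (intro DERIV_subset[OF _ sub]) (auto simp: det_solution_def)
      then have xdc: "continuous_on {t1..b} xd"
        using DERIV_continuous unfolding continuous_on_eq_continuous_within by blast
      have Xc: "continuous_on {t1..b} (\<lambda>t. X t \<omega>)" if "\<omega> \<in> space M" for \<omega>
        using sde that by (simp add: sde_solution_def b_def)
      have vbar: "h * sqrt (vbar \<mu> \<epsilon> \<sigma> t1 v0 t) \<le> \<bar>z\<bar> \<longleftrightarrow> h * sqrt (g t) \<le> f t * \<bar>z\<bar>"
        if "t \<in> {t1..b}" for t z
      proof -
        have "vbar \<mu> \<epsilon> \<sigma> t1 v0 t = (1 / f t)\<^sup>2 * g t"
          using that vbar_eq[of t1 t \<mu> \<epsilon> \<sigma> v0] continuous_on_subset[OF \<mu>'] \<epsilon>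
          by (simp add: f_def g_def b_def exp_minus divide_inverse)
        then have "sqrt (vbar \<mu> \<epsilon> \<sigma> t1 v0 t) = sqrt (g t) / f t"
          using fpos[of t] by (simp add: real_sqrt_mult)
        then show ?thesis using fpos[of t] by (simp add: divide_le_eq mult.commute)
      qed
      have "g b \<le> v0 + L * exp (2 * m * L / \<epsilon>)"
      proof -
        have "\<sigma> * 1 \<le> \<sigma> * h" using False \<sigma> by (intro mult_left_mono) auto
        also have "\<dots> \<le> b" using h(2) \<sigma> by (simp add: b_def field_simps)
        finally have "\<sigma> / b \<le> 1" using b by simp
        have bd: "(\<sigma> / b * f s)\<^sup>2 \<le> exp (2 * m * L / \<epsilon>)" if s: "s \<in> {t1..b}" for s
        proof -
          have "\<bar>alpha \<mu> s t1\<bar> \<le> m * (s - t1)"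
            using s assms bT m by (intro abs_alpha_le[OF \<mu>]) auto
          also have "\<dots> \<le> m * L" using s assms bT m by (intro mult_left_mono) (auto simp: L_def)
          finally have "- alpha \<mu> s t1 / \<epsilon> \<le> m * L / \<epsilon>"
            using \<epsilon> by (intro divide_right_mono) auto
          then have "f s \<le> exp (m * L / \<epsilon>)" by (simp add: f_def)
          then have "\<sigma> / b * f s \<le> 1 * exp (m * L / \<epsilon>)"
            using \<open>\<sigma> / b \<le> 1\<close> fpos[of s] by (intro mult_mono) auto
          then have "(\<sigma> / b * f s)\<^sup>2 \<le> (exp (m * L / \<epsilon>))\<^sup>2"
            using \<sigma> b fpos[of s] by (intro power_mono) auto
          then show ?thesis by (simp add: mult.assoc flip: exp_double)
        qed
        have "norm (integral {t1..b} (\<lambda>s. (\<sigma> / b * f s)\<^sup>2)) \<le> exp (2 * m * L / \<epsilon>) * (b - t1)"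
          using bd assms b by (intro integral_bound continuous_intros fc) auto
        also have "\<dots> \<le> exp (2 * m * L / \<epsilon>) * L"
          using assms bT by (intro mult_left_mono) (auto simp: L_def)
        finally show ?thesis by (simp add: g_def mult.commute)
      qed
      from ex_levels[OF \<open>0 < v0\<close> \<epsilon>(1) \<epsilon>1(1) m(1) L this]
      obtain n where n: "g b < v0 * exp (real n * b)" "real n \<le> C * b / \<epsilon>\<^sup>2"
        by (auto simp: b_def C_def)
      \<comment> \<open>From \<open>x^3 - z^3 = (x - z) * (x\<^sup>2 + x * z + z\<^sup>2)\<close>
        with a nonnegative quadratic form. The terms with \<open>\<mu>\<close> cancel against the
        derivative of \<open>f\<close>, so only this restoring part of the drift remains.\<close>
      define q where "q t \<omega> = f t * ((X t \<omega>)\<^sup>2 + X t \<omega> * xd t + (xd t)\<^sup>2) / \<epsilon>" for t \<omega>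
      have "\<exists>E\<in>sets M. {\<omega>\<in>space M. \<exists>t\<in>{t1..b}. h * sqrt (g t) \<le> f t * \<bar>X t \<omega> - xd t\<bar>} \<subseteq> E
            \<and> measure M E \<le> 8 * real n * exp (- (1 - b) * h\<^sup>2 / 2)"
      proof (rule confined_drift_exit_variance_scaled[where f' = "\<lambda>t. - (\<mu> t / \<epsilon>) * f t" and q = q
            and c = "\<sigma> / b" and \<beta> = "\<lambda>t \<omega>. (\<mu> t * X t \<omega> - (X t \<omega>)^3) / \<epsilon> - (\<mu> t * xd t - (xd t)^3) / \<epsilon>",
            OF W _ f' _ fpos _ _ _ _ _ g_def h(1) \<open>0 < v0\<close> b(1) n(1)])
        fix \<omega> assume \<omega>: "\<omega> \<in> space M"
        show "continuous_on {t1..b} (\<lambda>t. (\<mu> t * X t \<omega> - (X t \<omega>)^3) / \<epsilon> - (\<mu> t * xd t - (xd t)^3) / \<epsilon>)"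
          using \<epsilon> by (intro continuous_intros \<mu>' xdc Xc \<omega>) auto
        show "continuous_on {t1..b} (\<lambda>t. X t \<omega> - xd t)"
          by (intro continuous_intros xdc Xc \<omega>)
        fix t assume t: "t \<in> {t1..b}"
        have sub': "{t1..t} \<subseteq> {t1..b}" using t by auto
        \<comment> \<open>The differential equation of \<open>xd\<close> in integral form, to be
          subtracted from that of \<open>X\<close>.\<close>
        have 1: "((\<lambda>s. (\<mu> s * xd s - (xd s)^3) / \<epsilon>) has_integral (xd t - xd t1)) {t1..t}"
        proof (rule fundamental_theorem_of_calculus)
          fix s assume "s \<in> {t1..t}"
          then show "(xd has_vector_derivative (\<mu> s * xd s - (xd s)^3) / \<epsilon>) (at s within {t1..t})"
            using DERIV_subset[OF xd' sub'] sub' by (auto simp: has_real_derivative_iff_has_vector_derivative)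
        qed (use t in auto)
        have 2: "(\<lambda>s. (\<mu> s * X s \<omega> - (X s \<omega>)^3) / \<epsilon>) integrable_on {t1..t}"
          using \<epsilon> by (intro integrable_continuous_real continuous_on_subset[OF _ sub'] continuous_intros \<mu>' Xc \<omega>) auto
        have "X t \<omega> = xd t1 + 1 / \<epsilon> * integral {t1..t} (\<lambda>s. \<mu> s * X s \<omega> - (X s \<omega>)^3) + \<sigma> / b * W (t - t1) \<omega>"
          using sde \<omega> t by (simp add: sde_solution_def b_def)
        then show "X t \<omega> - xd t = integral {t1..t} (\<lambda>s. (\<mu> s * X s \<omega> - (X s \<omega>)^3) / \<epsilon> - (\<mu> s * xd s - (xd s)^3) / \<epsilon>)
            + \<sigma> / b * W (t - t1) \<omega>"
          using 2 has_integral_integrable[OF 1] integral_unique[OF 1]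
          by (simp add: Henstock_Kurzweil_Integration.integral_diff)
        show "f t * ((\<mu> t * X t \<omega> - (X t \<omega>)^3) / \<epsilon> - (\<mu> t * xd t - (xd t)^3) / \<epsilon>) + - (\<mu> t / \<epsilon>) * f t * (X t \<omega> - xd t)
            = - (q t \<omega> * (X t \<omega> - xd t))"
          using \<epsilon> by (simp add: q_def field_simps power2_eq_square power3_eq_cube)
        have "(X t \<omega>)\<^sup>2 + X t \<omega> * xd t + (xd t)\<^sup>2 = (X t \<omega> + xd t / 2)\<^sup>2 + 3 / 4 * (xd t)\<^sup>2"
          by (simp add: power2_eq_square algebra_simps)
        then show "0 \<le> q t \<omega>" using \<epsilon> fpos[of t] by (simp add: q_def)
      qed (use assms b \<epsilon> in \<open>auto intro!: continuous_intros \<mu>' fc\<close>)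
      then obtain E where E: "E \<in> sets M" "{\<omega>\<in>space M. \<exists>t\<in>{t1..b}. h * sqrt (g t) \<le> f t * \<bar>X t \<omega> - xd t\<bar>} \<subseteq> E"
        "measure M E \<le> 8 * real n * exp (- (1 - b) * h\<^sup>2 / 2)" by blast
      let ?S = "{\<omega>\<in>space M. exit_time (Bset \<mu> \<epsilon> \<sigma> t1 v0 xd h) t1 X \<omega> < sqrt \<epsilon>}"
      have "?S \<subseteq> {\<omega>\<in>space M. \<exists>t\<in>{t1..b}. h * sqrt (g t) \<le> f t * \<bar>X t \<omega> - xd t\<bar>}"
      proof safe
        fix \<omega> assume "exit_time (Bset \<mu> \<epsilon> \<sigma> t1 v0 xd h) t1 X \<omega> < sqrt \<epsilon>"
        from exit_time_Bset_less[OF this] obtain t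
          where t: "t \<in> {t1..b}" "h * sqrt (vbar \<mu> \<epsilon> \<sigma> t1 v0 t) \<le> \<bar>X t \<omega> - xd t\<bar>"
          unfolding b_def by blast
        then show "\<exists>t\<in>{t1..b}. h * sqrt (g t) \<le> f t * \<bar>X t \<omega> - xd t\<bar>"
          using vbar[OF t(1)] by blast
      qed
      then have "?S \<subseteq> E" using E(2) by simp
      \<comment> \<open>\<open>?S\<close> need not be measurable; \<open>measure\<close> is 0 in that case.\<close>
      then have "measure M ?S \<le> measure M E"
        using E(1) by (cases "?S \<in> sets M") (auto intro: finite_measure_mono simp: measure_notin_sets)
      also note E(3)
      also have "8 * real n * exp (- (1 - b) * h\<^sup>2 / 2) \<le> \<bar>alpha \<mu> b t1\<bar> / \<epsilon>\<^sup>2 * exp (- (1 - b) * h\<^sup>2 / 2)"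
      proof (rule mult_right_mono)
        \<comment> \<open>The factor \<open>b = sqrt \<epsilon>\<close> in the count of levels
          outweighs \<open>8 * C\<close>, so the prefactor is at most
          \<open>\<bar>alpha \<mu> b t1\<bar> / \<epsilon>\<^sup>2\<close>.\<close>
        have "8 * C * b \<le> 8 * C * (a0 / (8 * C))" using b r0' C by (intro mult_left_mono) auto
        then have "8 * C * b \<le> \<bar>alpha \<mu> b t1\<bar>" using C \<alpha> by simp
        then have "8 * C * b / \<epsilon>\<^sup>2 \<le> \<bar>alpha \<mu> b t1\<bar> / \<epsilon>\<^sup>2" by (rule divide_right_mono) simp
        then show "8 * real n \<le> \<bar>alpha \<mu> b t1\<bar> / \<epsilon>\<^sup>2" using n(2) by simp
      qed simp
      finally show ?thesis by (simp add: b_def)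
    qed
  qed
  \<comment> \<open>The witnesses are \<open>h0 = 1\<close>,
    \<open>\<epsilon>0 = r0\<^sup>2\<close>, \<open>K1 = 0\<close>, \<open>K2 = 1 / 2\<close> and
    \<open>K3 = 0\<close>. \<open>K2\<close> is the loss from the level ratio
    \<open>exp (sqrt \<epsilon>)\<close>; the cubic term pulls the path towards \<open>xd\<close>
    and so adds nothing to \<open>K3\<close>, and the level count has been absorbed without an extra
    \<open>K1\<close>.\<close>
  show ?thesis
  proof (rule exI[of _ 1], rule conjI, simp, rule exI[of _ "r0\<^sup>2"], rule conjI, use r0 in simp,
      rule exI[of _ 0], rule exI[of _ "1 / 2"], rule exI[of _ 0], intro allI impI)
    fix \<epsilon> \<sigma> h :: real and M :: "'a measure" and W X xd
    assume "0 < \<epsilon> \<and> \<epsilon> \<le> r0\<^sup>2 \<and> 0 < \<sigma> \<and> 0 < h \<and> h \<le> 1 * sqrt \<epsilon> / \<sigma>"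
      and "brownian_motion M W \<and> det_solution \<mu> \<epsilon> t0 T x0 xd \<and>
        sde_solution M W \<mu> \<epsilon> \<sigma> t1 (sqrt \<epsilon>) (xd t1) X"
    then show "measure M {\<omega>\<in>space M. exit_time (Bset \<mu> \<epsilon> \<sigma> t1 v0 xd h) t1 X \<omega> < sqrt \<epsilon>}
       \<le> (\<bar>alpha \<mu> (sqrt \<epsilon>) t1\<bar> + 0 * \<epsilon>) / \<epsilon>\<^sup>2
          * exp (- (1/2 - 1/2 * sqrt \<epsilon> - 0 * \<sigma>\<^sup>2 * h\<^sup>2 / \<epsilon>) * h\<^sup>2)"
      using main[of \<epsilon> \<sigma> h M W xd X] by (simp add: diff_divide_distrib left_diff_distrib)
  qed
qed

end
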